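(* Let $\{X_t\}_{t\in\mathbb N}$ be the simple random walk, started at $X_0=x_0\in V_0$, on an increasing sequence $\{\mathbb G_t\}$ of finite connected subgraphs of $\mathbb G_\infty$. Assume $\{X_t\}$ is uniformly lazy, i.e. for some $\gamma\in(0,1/2]$, $P(t,x;t+1,x)\ge\gamma$ for all $t\in\mathbb N$, $x\in V_t$, and assume $\{\mathbb G_t\}$ have uniformly bounded degrees, i.e. $\sup_{t\in\mathbb N}\sup_{x\in V_t}\pi^{(t)}(x)<\infty$. If $$\sum_{t=1}^\infty v(t)^{-1}<\infty$$ and in addition $$\sum_{t=1}^\infty\exp\Big\{-\sum_{u=\lfloor t/2\rfloor}^{t-1}\Phi_u^2\Big\}<\infty,$$ then $\{X_t\}$ is (strong) transient.
   Context: Here $\mathbb N=\{0,1,2,\dots\}$. $\mathbb G_\infty=(V,E)$ is an infinite, locally finite, connected graph, with multiple edges and self-loops allowed. $\mathbb G_t=(V,E_t)$, $t\in\mathbb N$, are subgraphs with $E_t\subseteq E_{t+1}\subseteq\cdots\subseteq E$. $V_t:=\{x\in V:\exists y\in V,\ y\ne x,\ (x,y)\in E_t\}$ is the set of non-isolated vertices at time $t$; $\mathbb G_t$ is identified with $(V_t,E_t)$, and it is assumed throughout that every $\mathbb G_t$, $t<\infty$, is connected and finite ($|V_t|<\infty$). For $x,y\in V_t$, $\pi^{(t)}(x,y)$ is the number of (multiple) edges of $E_t$ between $x$ and $y$, with $\pi^{(t)}(x,x)$ counting self-loops at $x$. For $x\in V_t$ and $A,B\subseteq V_t$: $\pi^{(t)}(x)=\sum_{y\in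 V_t}\pi^{(t)}(x,y)$, $\pi^{(t)}(A,B)=\sum_{x\in A,\,y\in B}\pi^{(t)}(x,y)$, $\pi^{(t)}(A)=\sum_{x\in A}\pi^{(t)}(x)$. The volume is $v(t):=\pi^{(t)}(V_t)$. The Cheeger constant is $$\Phi_t:=\inf\Big\{\frac{\pi^{(t)}(A,A^c)}{\pi^{(t)}(A)}:\ \emptyset\ne A\subseteq V_t,\ \pi^{(t)}(A)\le \tfrac{v(t)}2\Big\},\quad A^c=V_t\setminus A.$$ The simple random walk $\{X_t\}$ on $\{\mathbb G_t\}$ is the time-inhomogeneous Markov chain with $P(t,x;t+1,y)=\mathbb P(X_{t+1}=y\mid X_t=x)=\pi^{(t)}(x,y)/\pi^{(t)}(x)$, $x,y\in V_t$. $\{X_t\}$ with $X_0=x_0$ is called (strong) transient if $\mathbb E_{x_0}[N_0]<\infty$, where $N_0:=\sum_{t=0}^\infty 1_{\{X_t=x_0\}}$. *)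

theory Defs
  imports "HOL-Probability.Probability"
begin

section \<open>Undirected multigraphs\<close>

text \<open>
  An undirected multigraph is given by a vertex set, a set \<open>F\<close> of edges (edges are abstract
  names, which allows multiplicities), and a map \<open>ends\<close> sending an edge to the set of its
  endpoints; \<open>ends e = {x, y}\<close> with \<open>x \<noteq> y\<close> for a proper edge, \<open>ends e = {x}\<close> for a self-loop
  at \<open>x\<close>. All graphs \<open>\<G>\<^sub>\<infinity>, \<G>\<^sub>0, \<G>\<^sub>1, \<dots>\<close> share the same map \<open>ends\<close> and differ only in \<open>F\<close>.
\<close>

definition adj :: "('e \<Rightarrow> 'a set) \<Rightarrow> 'e set \<Rightarrow> ('a \<times> 'a) set" where
  "adj ends F = {(x, y). \<exists>e\<in>F. ends e = {x, y}}"

definition connected_graph :: "'a set \<Rightarrow> ('e \<Rightarrow> 'a set) \<Rightarrow> 'e set \<Rightarrow> bool" where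
  "connected_graph W ends F \<longleftrightarrow> (\<forall>x\<in>W. \<forall>y\<in>W. (x, y) \<in> (adj ends F)\<^sup>*)"

definition nonisolated :: "('e \<Rightarrow> 'a set) \<Rightarrow> 'e set \<Rightarrow> 'a set" where
  "nonisolated ends F = {x. \<exists>y. y \<noteq> x \<and> (x, y) \<in> adj ends F}"

text \<open>
  The last three assumptions concern \<open>(V\<^sub>t, E\<^sub>t)\<close> with \<open>V\<^sub>t = nonisolated ends (E\<^sub>t)\<close>, a subset
  of \<open>V\<close>. Self-loops of \<open>E\<^sub>t\<close> at vertices outside \<open>V\<^sub>t\<close> are harmless: they enter none of the
  quantities below.
\<close>

locale growing_graphs =
  fixes V :: "'a set" and E :: "'e set" and ends :: "'e \<Rightarrow> 'a set" and Et :: "nat \<Rightarrow> 'e set"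
  assumes ends_in_V: "\<And>e. e \<in> E \<Longrightarrow> \<exists>x\<in>V. \<exists>y\<in>V. ends e = {x, y}"
    and infinite_V: "infinite V"
    and locally_finite: "\<And>x. x \<in> V \<Longrightarrow> finite {e \<in> E. x \<in> ends e}"
    and connected_G: "connected_graph V ends E"
    and Et_subset: "\<And>t. Et t \<subseteq> E"
    and Et_mono: "\<And>t. Et t \<subseteq> Et (Suc t)"
    and finite_Vt: "\<And>t. finite (nonisolated ends (Et t))"
    and connected_Gt: "\<And>t. connected_graph (nonisolated ends (Et t)) ends (Et t)"


section \<open>Edge counts, volume and Cheeger constant\<close>

text \<open>A self-loop at \<open>x\<close> contributes one (not two) to \<open>mult ends F x x\<close>.\<close>

definition mult :: "('e \<Rightarrow> 'a set) \<Rightarrow> 'e set \<Rightarrow> 'a \<Rightarrow> 'a \<Rightarrow> nat" where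
  "mult ends F x y = card {e \<in> F. ends e = {x, y}}"

definition deg :: "('e \<Rightarrow> 'a set) \<Rightarrow> 'e set \<Rightarrow> 'a \<Rightarrow> nat" where
  "deg ends F x = (\<Sum>y\<in>nonisolated ends F. mult ends F x y)"

definition mult_sets :: "('e \<Rightarrow> 'a set) \<Rightarrow> 'e set \<Rightarrow> 'a set \<Rightarrow> 'a set \<Rightarrow> nat" where
  "mult_sets ends F A B = (\<Sum>x\<in>A. \<Sum>y\<in>B. mult ends F x y)"

definition deg_set :: "('e \<Rightarrow> 'a set) \<Rightarrow> 'e set \<Rightarrow> 'a set \<Rightarrow> nat" where
  "deg_set ends F A = (\<Sum>x\<in>A. deg ends F x)"

definition vol :: "('e \<Rightarrow> 'a set) \<Rightarrow> 'e set \<Rightarrow> nat" where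
  "vol ends F = deg_set ends F (nonisolated ends F)"

definition cheeger :: "('e \<Rightarrow> 'a set) \<Rightarrow> 'e set \<Rightarrow> real" where
  "cheeger ends F =
     Inf {real (mult_sets ends F A (nonisolated ends F - A)) / real (deg_set ends F A) | A.
            A \<noteq> {} \<and> A \<subseteq> nonisolated ends F \<and>
            real (deg_set ends F A) \<le> real (vol ends F) / 2}"


section \<open>Simple random walk and strong transience\<close>

text \<open>
  Time-inhomogeneous Markov chain on the state space \<open>S\<close>, where \<open>P t x y\<close> is the probability of
  stepping from \<open>x\<close> at time \<open>t\<close> to \<open>y\<close> at time \<open>t + 1\<close>. Only histories of positive probability
  are constrained, so \<open>P t x\<close> is irrelevant at states \<open>x\<close> not visited at time \<open>t\<close>.
\<close>

definition markov_chain ::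
    "'w measure \<Rightarrow> 'a set \<Rightarrow> (nat \<Rightarrow> 'a \<Rightarrow> 'a \<Rightarrow> real) \<Rightarrow> (nat \<Rightarrow> 'w \<Rightarrow> 'a) \<Rightarrow> bool" where
  "markov_chain M S P X \<longleftrightarrow>
     prob_space M \<and>
     (\<forall>t. X t \<in> measurable M (count_space S)) \<and>
     (\<forall>t xs. \<forall>y\<in>S. \<P>(\<omega> in M. \<forall>i\<le>t. X i \<omega> = xs i) > 0 \<longrightarrow>
        \<P>(\<omega> in M. X (Suc t) \<omega> = y \<bar> \<forall>i\<le>t. X i \<omega> = xs i) = P t (xs t) y)"

text \<open>
  For \<open>x \<in> V\<^sub>t\<close> and \<open>y \<notin> V\<^sub>t\<close> the transition probability is \<open>0\<close>, as no edge of \<open>E\<^sub>t\<close> joins them.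
\<close>

definition srw_trans ::
    "('e \<Rightarrow> 'a set) \<Rightarrow> (nat \<Rightarrow> 'e set) \<Rightarrow> nat \<Rightarrow> 'a \<Rightarrow> 'a \<Rightarrow> real" where
  "srw_trans ends Et t x y = real (mult ends (Et t) x y) / real (deg ends (Et t) x)"

definition simple_random_walk ::
    "'w measure \<Rightarrow> 'a set \<Rightarrow> ('e \<Rightarrow> 'a set) \<Rightarrow> (nat \<Rightarrow> 'e set) \<Rightarrow> 'a \<Rightarrow> (nat \<Rightarrow> 'w \<Rightarrow> 'a) \<Rightarrow> bool"
  where
  "simple_random_walk M V ends Et x0 X \<longleftrightarrow>
     markov_chain M V (srw_trans ends Et) X \<and> (AE \<omega> in M. X 0 \<omega> = x0)"

definition num_visits :: "(nat \<Rightarrow> 'w \<Rightarrow> 'a) \<Rightarrow> 'a \<Rightarrow> 'w \<Rightarrow> ennreal" where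
  "num_visits X x0 \<omega> = (\<Sum>t. indicator {\<omega>. X t \<omega> = x0} \<omega>)"

definition strong_transient :: "'w measure \<Rightarrow> (nat \<Rightarrow> 'w \<Rightarrow> 'a) \<Rightarrow> 'a \<Rightarrow> bool" where
  "strong_transient M X x0 \<longleftrightarrow> (\<integral>\<^sup>+\<omega>. num_visits X x0 \<omega> \<partial>M) < \<infinity>"

end

theory Submission
  imports Defs
begin

text \<open>
  Write \<open>u\<^sub>t\<close> for the law of \<open>X\<^sub>t\<close>, \<open>\<pi>\<^sub>t\<close> for the degree and \<open>h\<^sub>t = u\<^sub>t / \<pi>\<^sub>t\<close>, and let
  \<open>g\<^sub>s(x)\<close> be the probability of moving from \<open>(s, x)\<close> to \<open>(t, x\<^sub>0)\<close>. Then
  \<open>P(X\<^sub>t = x\<^sub>0) = \<Sum>\<^sub>x \<pi>\<^sub>s h\<^sub>s g\<^sub>s \<le> \<parallel>h\<^sub>s\<parallel> \<parallel>g\<^sub>s\<parallel>\<close> for every \<open>s \<le> t\<close>, the norms being those of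
  \<open>\<ell>\<^sup>2(\<pi>\<^sub>s)\<close>. Since the degrees increase, \<open>\<parallel>h\<^sub>s\<parallel>\<close> decreases in \<open>s\<close> and \<open>\<parallel>g\<^sub>s\<parallel>\<close> increases,
  and as long as the squared norms exceed a constant times \<open>1/v(s)\<close> each step contracts them
  in two ways: by a factor \<open>exp(- (1 + \<gamma>) \<Phi>\<^sub>s\<^sup>2)\<close> (Cheeger) and, as boundaries contain at
  least one edge, by \<open>z \<mapsto> z (1 - c z\<^sup>2)\<close> (Nash).

  The Cheeger contraction alone gives about \<open>exp(- (1 + \<gamma>)/2 \<Sum> \<Phi>\<^sub>s\<^sup>2)\<close> for the product of the
  norms, which loses almost a factor 2 in the exponent when \<open>\<gamma>\<close> is small. The Nash contraction
  contributes a further factor \<open>t\<^sup>-\<^sup>1\<^sup>/\<^sup>4\<close> for \<open>h\<close> on \<open>[0, t/2]\<close> and \<open>L\<^sup>-\<^sup>1\<^sup>/\<^sup>4\<close> for \<open>g\<close> on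
  \<open>[t - L, t]\<close>, where \<open>L\<close> is the longest window carrying a negligible part \<open>(\<gamma>/8) ln t\<close> of the
  sum \<open>\<Sum> \<Phi>\<^sub>s\<^sup>2\<close>. Short windows are rare on average over \<open>t\<close> in a dyadic block, and by Young's
  inequality the exponent \<open>(1 + \<gamma>)/2 > 1/2\<close> is then enough.
\<close>

section \<open>Contraction of the energy in a lazy network\<close>

text \<open>On the line, matching two points with two others in sorted order minimises the total
  distance; the right side is one of the possible matchings.\<close>

lemma abs_diff_min_max_le:
  fixes a b c d :: real
  shows "\<bar>min a b - min c d\<bar> + \<bar>max a b - max c d\<bar> \<le> \<bar>a - d\<bar> + \<bar>c - b\<bar>"
  by (auto simp: min_def max_def abs_if)

lemma sum_boundary:
  fixes w :: "'a \<Rightarrow> 'a \<Rightarrow> real"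
  assumes "finite W" "A \<subseteq> W" and sym: "\<And>x y. w x y = w y x"
  shows "(\<Sum>x\<in>W. \<Sum>y\<in>W. w x y * of_bool ((x \<in> A) \<noteq> (y \<in> A))) = 2 * (\<Sum>x\<in>A. \<Sum>y\<in>W - A. w x y)"
proof -
  have fin: "finite A" "finite (W - A)" using assms finite_subset by auto
  have split: "(\<Sum>x\<in>W. f x) = (\<Sum>x\<in>A. f x) + (\<Sum>x\<in>W - A. f x)" for f :: "'a \<Rightarrow> real"
    using assms by (metis add.commute sum.subset_diff)
  have 1: "(\<Sum>y\<in>W. w x y * of_bool ((x \<in> A) \<noteq> (y \<in> A))) = (\<Sum>y\<in>W - A. w x y)" if "x \<in> A" for x
    unfolding split using that by simp
  have 2: "(\<Sum>y\<in>W. w x y * of_bool ((x \<in> A) \<noteq> (y \<in> A))) = (\<Sum>y\<in>A. w x y)" if "x \<in> W - A" for x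
    unfolding split using that by simp
  have "(\<Sum>x\<in>W. \<Sum>y\<in>W. w x y * of_bool ((x \<in> A) \<noteq> (y \<in> A)))
      = (\<Sum>x\<in>A. \<Sum>y\<in>W - A. w x y) + (\<Sum>x\<in>W - A. \<Sum>y\<in>A. w x y)"
    by (subst split) (intro arg_cong2[of _ _ _ _ "(+)"] sum.cong refl 1 2)
  also have "(\<Sum>x\<in>W - A. \<Sum>y\<in>A. w x y) = (\<Sum>x\<in>A. \<Sum>y\<in>W - A. w x y)"
    by (subst sum.swap) (simp add: sym)
  finally show ?thesis by simp
qed

text \<open>The lowest positive level of \<open>F\<close> is peeled off, by induction on the size of
  the support; each layer is paid for by the boundary of a superlevel set. The half compensates for
  counting every pair in both orders. Isoperimetry is asked only of sets inside the support, which
  is what truncated functions can offer.\<close>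

lemma coarea:
  fixes w :: "'a \<Rightarrow> 'a \<Rightarrow> real"
  assumes fin: "finite W" and sym: "\<And>x y. w x y = w y x"
    and "\<And>x. x \<in> W \<Longrightarrow> 0 \<le> F x"
    and "\<And>A. A \<noteq> {} \<Longrightarrow> A \<subseteq> {x\<in>W. 0 < F x} \<Longrightarrow> (\<Sum>x\<in>A. q x) \<le> (\<Sum>x\<in>A. \<Sum>y\<in>W - A. w x y)"
  shows "(\<Sum>x\<in>W. q x * F x) \<le> (\<Sum>x\<in>W. \<Sum>y\<in>W. w x y * \<bar>F x - F y\<bar>) / 2"
  using assms(3,4)
proof (induction "card {x\<in>W. 0 < F x}" arbitrary: F rule: less_induct)
  case less
  define A where "A = {x\<in>W. 0 < F x}"
  have A: "finite A" "A \<subseteq> W" using fin by (auto simp: A_def)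
  have F0: "F x = 0" if "x \<in> W - A" for x
    using that less.prems(1)[of x] by (auto simp: A_def)
  show ?case
  proof (cases "A = {}")
    case True
    then have "F x = 0" if "x \<in> W" for x using F0 that by auto
    then show ?thesis by simp
  next
    case False
    define m where "m = Min (F ` A)"
    have m: "m \<le> F x" if "x \<in> A" for x using that A by (simp add: m_def)
    have "m \<in> F ` A" unfolding m_def using A False by (intro Min_in) auto
    then obtain x0 where x0: "x0 \<in> A" "F x0 = m" by auto
    then have mpos: "0 < m" by (auto simp: A_def)
    \<comment> \<open>Lowering \<open>F\<close> by its least positive value keeps it nonnegative and
      removes at least the minimiser \<open>x0\<close> from the support.\<close>
    define F' where "F' x = F x - m * of_bool (x \<in> A)" for x
    define A' where "A' = {x\<in>W. 0 < F' x}"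
    have F'nn: "0 \<le> F' x" if "x \<in> W" for x
      using m[of x] less.prems(1)[OF that] by (auto simp: F'_def)
    have A'A: "A' \<subseteq> A"
    proof
      fix x assume x: "x \<in> A'"
      then have "x \<in> W" "0 < F x" using mpos by (auto simp: A'_def F'_def of_bool_def split: if_splits)
      then show "x \<in> A" by (simp add: A_def)
    qed
    have "x0 \<notin> A'" using x0 by (simp add: A'_def F'_def)
    then have "A' \<subset> A" using A'A x0 by auto
    then have card: "card A' < card A" using A by (simp add: psubset_card_mono)
    have IH: "(\<Sum>x\<in>W. q x * F' x) \<le> (\<Sum>x\<in>W. \<Sum>y\<in>W. w x y * \<bar>F' x - F' y\<bar>) / 2"
      by (rule less.hyps) (use card A'A F'nn less.prems(2) in \<open>auto simp: A_def A'_def\<close>)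
    \<comment> \<open>\<open>F\<close> vanishes off \<open>A\<close> and is at least
      \<open>m\<close> on it, so pairs on one side of \<open>A\<close> keep their difference and
      each crossing pair loses exactly \<open>m\<close>.\<close>
    have abs: "\<bar>F x - F y\<bar> = \<bar>F' x - F' y\<bar> + m * of_bool ((x \<in> A) \<noteq> (y \<in> A))"
      if "x \<in> W" "y \<in> W" for x y
      using F0[of x] F0[of y] m[of x] m[of y] that mpos by (auto simp: F'_def)
    have "(\<Sum>x\<in>W. \<Sum>y\<in>W. w x y * \<bar>F x - F y\<bar>)
        = (\<Sum>x\<in>W. \<Sum>y\<in>W. w x y * \<bar>F' x - F' y\<bar> + m * (w x y * of_bool ((x \<in> A) \<noteq> (y \<in> A))))"
      by (intro sum.cong refl) (simp add: abs algebra_simps)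
    also have "\<dots> = (\<Sum>x\<in>W. \<Sum>y\<in>W. w x y * \<bar>F' x - F' y\<bar>)
        + m * (2 * (\<Sum>x\<in>A. \<Sum>y\<in>W - A. w x y))"
      unfolding sum_boundary[of W A w, OF fin A(2) sym, symmetric]
      by (simp add: sum.distrib sum_distrib_left)
    finally have 1: "(\<Sum>x\<in>W. \<Sum>y\<in>W. w x y * \<bar>F x - F y\<bar>) / 2
        = (\<Sum>x\<in>W. \<Sum>y\<in>W. w x y * \<bar>F' x - F' y\<bar>) / 2 + m * (\<Sum>x\<in>A. \<Sum>y\<in>W - A. w x y)"
      by simp
    have "(\<Sum>x\<in>W. q x * F x) = (\<Sum>x\<in>W. q x * F' x) + (\<Sum>x\<in>W. m * (q x * of_bool (x \<in> A)))"
      unfolding sum.distrib[symmetric] by (intro sum.cong refl) (simp add: F'_def algebra_simps)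
    also have "(\<Sum>x\<in>W. m * (q x * of_bool (x \<in> A))) = m * (\<Sum>x\<in>A. q x)"
      using A fin by (simp add: sum_distrib_left[symmetric] sum.If_cases Int_absorb1 Int_def[symmetric] if_distrib of_bool_def cong: if_cong)
    also have "\<dots> \<le> m * (\<Sum>x\<in>A. \<Sum>y\<in>W - A. w x y)"
      using mpos less.prems(2)[of A] False by (simp add: A_def)
    finally show ?thesis using 1 IH by simp
  qed
qed

section \<open>Lazy networks, their averaging operator and its energy\<close>

locale lazy_network =
  fixes W :: "'a set" and w :: "'a \<Rightarrow> 'a \<Rightarrow> real" and \<gamma> :: real
  assumes fin: "finite W"
    and sym: "w x y = w y x"
    and nonneg: "0 \<le> w x y"
    and gamma: "0 < \<gamma>" "\<gamma> \<le> 1 / 2"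
    and pos: "x \<in> W \<Longrightarrow> 0 < (\<Sum>y\<in>W. w x y)"
    and lazy: "x \<in> W \<Longrightarrow> \<gamma> * (\<Sum>y\<in>W. w x y) \<le> w x x"
begin

definition d :: "'a \<Rightarrow> real" where "d x = (\<Sum>y\<in>W. w x y)"

definition v :: real where "v = (\<Sum>x\<in>W. d x)"

definition P :: "('a \<Rightarrow> real) \<Rightarrow> 'a \<Rightarrow> real" where
  "P h x = (\<Sum>y\<in>W. w x y * h y) / d x"

definition energy :: "('a \<Rightarrow> real) \<Rightarrow> real" where
  "energy h = (\<Sum>x\<in>W. d x * (h x)\<^sup>2)"

text \<open>Taking the fraction \<open>\<gamma>\<close> of laziness out of the loops does not change the boundary of a set but
  lowers all degrees to \<open>(1 - \<gamma>) d\<close>; this is where the factor \<open>1 / (1 - \<gamma>)\<close> is gained.\<close>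

definition w' :: "'a \<Rightarrow> 'a \<Rightarrow> real" where
  "w' x y = w x y - (if x = y \<and> x \<in> W then \<gamma> * d x else 0)"

lemma d_pos: "x \<in> W \<Longrightarrow> 0 < d x"
  using pos by (simp add: d_def)

lemma d_P: "x \<in> W \<Longrightarrow> d x * P h x = (\<Sum>y\<in>W. w x y * h y)"
  using d_pos[of x] by (simp add: P_def)

lemma sum_weights_right: "(\<Sum>x\<in>W. \<Sum>y\<in>W. w x y * f y) = (\<Sum>x\<in>W. d x * f x)"
  by (subst sum.swap) (simp add: d_def sum_distrib_right sym)

lemma sum_weights_left: "(\<Sum>x\<in>W. \<Sum>y\<in>W. w x y * f x) = (\<Sum>x\<in>W. d x * f x)"
  by (simp add: d_def sum_distrib_right)

lemma sum_d_P: "(\<Sum>x\<in>W. d x * P h x) = (\<Sum>x\<in>W. d x * h x)"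
  by (simp add: d_P sum_weights_right)

lemma P_nonneg: "(\<And>x. x \<in> W \<Longrightarrow> 0 \<le> h x) \<Longrightarrow> x \<in> W \<Longrightarrow> 0 \<le> P h x"
  using d_pos[of x] unfolding P_def by (intro divide_nonneg_pos sum_nonneg mult_nonneg_nonneg nonneg) auto

text \<open>The loop at \<open>x\<close> alone contributes this much. It keeps the contraction ratio
  of the norm at least \<gamma>.\<close>

lemma P_ge:
  assumes "\<And>x. x \<in> W \<Longrightarrow> 0 \<le> h x" "x \<in> W"
  shows "\<gamma> * h x \<le> P h x"
proof -
  have "\<gamma> * d x * h x \<le> w x x * h x"
    using lazy[OF assms(2)] assms by (intro mult_right_mono) (auto simp: d_def)
  also have "\<dots> \<le> (\<Sum>y\<in>W. w x y * h y)"
    using assms fin by (intro member_le_sum) (auto intro!: mult_nonneg_nonneg nonneg)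
  finally show ?thesis
    using d_pos[OF assms(2)] by (simp add: P_def field_simps)
qed

lemma energy_nonneg: "0 \<le> energy h"
  unfolding energy_def using d_pos by (intro sum_nonneg mult_nonneg_nonneg) (auto intro: less_imp_le)

text \<open>Cauchy-Schwarz against the weights at each vertex, after which the symmetry of
  \<open>w\<close> sums the squares back to the energy.\<close>

lemma energy_P_le: "energy (P h) \<le> energy h"
proof -
  have "d x * (P h x)\<^sup>2 \<le> (\<Sum>y\<in>W. w x y * (h y)\<^sup>2)" if x: "x \<in> W" for x
  proof -
    have "(\<Sum>y\<in>W. w x y * h y)\<^sup>2 = (\<Sum>y\<in>W. sqrt (w x y) * (sqrt (w x y) * h y))\<^sup>2"
      by (intro arg_cong[where f = "\<lambda>s. s\<^sup>2"] sum.cong refl) (simp add: nonneg flip: mult.assoc)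
    also have "\<dots> \<le> (\<Sum>y\<in>W. (sqrt (w x y))\<^sup>2) * (\<Sum>y\<in>W. (sqrt (w x y) * h y)\<^sup>2)"
      by (rule Cauchy_Schwarz_ineq_sum)
    also have "\<dots> = d x * (\<Sum>y\<in>W. w x y * (h y)\<^sup>2)"
      by (simp add: power_mult_distrib nonneg d_def)
    finally have "d x * (d x * (P h x)\<^sup>2) \<le> d x * (\<Sum>y\<in>W. w x y * (h y)\<^sup>2)"
      unfolding d_P[OF x, symmetric] by (simp add: power2_eq_square mult_ac)
    then show ?thesis using d_pos[OF x] by simp
  qed
  then have "energy (P h) \<le> (\<Sum>x\<in>W. \<Sum>y\<in>W. w x y * (h y)\<^sup>2)"
    unfolding energy_def by (rule sum_mono)
  then show ?thesis by (simp add: sum_weights_right energy_def)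
qed

lemma w'_nonneg: "0 \<le> w' x y"
  using lazy[of x] nonneg[of x y] by (auto simp: w'_def d_def)

lemma w'_sym: "w' x y = w' y x"
  by (auto simp: w'_def sym)

lemma sum_w': "(\<Sum>x\<in>W. \<Sum>y\<in>W. w' x y * f x y) =
    (\<Sum>x\<in>W. \<Sum>y\<in>W. w x y * f x y) - \<gamma> * (\<Sum>x\<in>W. d x * f x x)"
proof -
  have "(\<Sum>y\<in>W. w' x y * f x y) = (\<Sum>y\<in>W. w x y * f x y) - \<gamma> * (d x * f x x)" if "x \<in> W" for x
  proof -
    have "(\<Sum>y\<in>W. w' x y * f x y)
        = (\<Sum>y\<in>W. w x y * f x y - (if x = y then \<gamma> * (d x * f x x) else 0))"
      using that by (intro sum.cong refl) (auto simp: w'_def algebra_simps)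
    then show ?thesis using that fin by (simp add: sum_subtractf)
  qed
  then show ?thesis by (simp add: sum_subtractf sum_distrib_left)
qed

text \<open>On each pair the difference of squares factors into sum and difference. Cauchy-Schwarz
  over all pairs leaves the product of the sums of \<open>(a + h)^2\<close> and
  \<open>(a - h)^2\<close>, which are \<open>2 * (1 - \<gamma>) * z\<close> plus and minus twice the
  cross term, because \<open>w'\<close> has degrees \<open>(1 - \<gamma>) * d\<close>.\<close>

lemma variation_le:
  assumes "energy a = z" "energy h = z"
  shows "(\<Sum>x\<in>W. \<Sum>y\<in>W. w' x y * \<bar>(a x)\<^sup>2 - (h y)\<^sup>2\<bar>)\<^sup>2
    \<le> 4 * (((1 - \<gamma>) * z)\<^sup>2 - (\<Sum>x\<in>W. \<Sum>y\<in>W. w' x y * (a x * h y))\<^sup>2)" (is "?S\<^sup>2 \<le> 4 * (_ - ?T\<^sup>2)")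
proof -
  have A: "(\<Sum>x\<in>W. \<Sum>y\<in>W. w' x y * (a x)\<^sup>2) = (1 - \<gamma>) * z"
    unfolding sum_w' sum_weights_left using assms by (simp add: energy_def algebra_simps)
  have H: "(\<Sum>x\<in>W. \<Sum>y\<in>W. w' x y * (h y)\<^sup>2) = (1 - \<gamma>) * z"
    unfolding sum_w' sum_weights_right using assms by (simp add: energy_def algebra_simps)
  define p m where "p = (\<lambda>(x, y). sqrt (w' x y) * \<bar>a x + h y\<bar>)"
    and "m = (\<lambda>(x, y). sqrt (w' x y) * \<bar>a x - h y\<bar>)"
  have "p (x, y) * m (x, y) = w' x y * \<bar>(a x)\<^sup>2 - (h y)\<^sup>2\<bar>" for x y
  proof -
    have "p (x, y) * m (x, y) = (sqrt (w' x y) * sqrt (w' x y)) * (\<bar>a x + h y\<bar> * \<bar>a x - h y\<bar>)"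
      unfolding p_def m_def by simp
    also have "\<dots> = w' x y * \<bar>(a x)\<^sup>2 - (h y)\<^sup>2\<bar>"
      using w'_nonneg[of x y] by (simp add: square_diff_square_factored power2_eq_square flip: abs_mult)
    finally show ?thesis .
  qed
  then have "?S = (\<Sum>e\<in>W \<times> W. p e * m e)"
    by (simp add: sum.cartesian_product del: split_paired_all) (auto intro!: sum.cong)
  then have "?S\<^sup>2 \<le> (\<Sum>e\<in>W \<times> W. (p e)\<^sup>2) * (\<Sum>e\<in>W \<times> W. (m e)\<^sup>2)"
    by (simp add: Cauchy_Schwarz_ineq_sum)
  also have "(\<Sum>e\<in>W \<times> W. (p e)\<^sup>2) = (\<Sum>x\<in>W. \<Sum>y\<in>W. w' x y * (a x)\<^sup>2 + w' x y * (h y)\<^sup>2 + 2 * (w' x y * (a x * h y)))"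
    unfolding sum.cartesian_product p_def
    by (intro sum.cong refl) (auto simp: power_mult_distrib w'_nonneg power2_sum algebra_simps)
  also have "\<dots> = 2 * ((1 - \<gamma>) * z) + 2 * ?T"
    by (simp add: sum.distrib A H sum_distrib_left)
  also have "(\<Sum>e\<in>W \<times> W. (m e)\<^sup>2) = (\<Sum>x\<in>W. \<Sum>y\<in>W. w' x y * (a x)\<^sup>2 + w' x y * (h y)\<^sup>2 - 2 * (w' x y * (a x * h y)))"
    unfolding sum.cartesian_product m_def
    by (intro sum.cong refl) (auto simp: power_mult_distrib w'_nonneg power2_diff algebra_simps)
  also have "\<dots> = 2 * ((1 - \<gamma>) * z) - 2 * ?T"
    by (simp add: sum.distrib sum_subtractf A H sum_distrib_left)
  finally show ?thesis by (simp add: power2_eq_square algebra_simps)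
qed

text \<open>Comparing two different functions, instead of one function with itself, bounds the norm of \<open>P h\<close>
  directly and avoids any loss from negative eigenvalues of \<open>P\<close>. Isoperimetry is applied to the level
  sets of the minimum and the maximum of the two functions.\<close>

lemma variation_ge:
  assumes nn: "0 \<le> r"
    and iso: "\<And>A. A \<noteq> {} \<Longrightarrow> A \<subseteq> {x\<in>W. r < (a x)\<^sup>2 \<or> r < (h x)\<^sup>2}
      \<Longrightarrow> (\<Sum>x\<in>A. q x) \<le> (\<Sum>x\<in>A. \<Sum>y\<in>W - A. w x y)"
  shows "(\<Sum>x\<in>W. q x * (max 0 ((a x)\<^sup>2 - r) + max 0 ((h x)\<^sup>2 - r)))
    \<le> (\<Sum>x\<in>W. \<Sum>y\<in>W. w' x y * \<bar>(a x)\<^sup>2 - (h y)\<^sup>2\<bar>)"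
proof -
  \<comment> \<open>Truncation at \<open>r\<close> puts every point where one of these functions is
    positive inside the region to which \<open>iso\<close> applies.\<close>
  define \<alpha> \<beta> where "\<alpha> x = max 0 ((a x)\<^sup>2 - r)" and "\<beta> x = max 0 ((h x)\<^sup>2 - r)" for x
  \<comment> \<open>Minimum and maximum have the same sum as \<alpha> and \<beta>, and the variation
    of each with itself, as \<open>coarea\<close> needs it, is together dominated by the variation
    between the two functions.\<close>
  define F G where "F x = min (\<alpha> x) (\<beta> x)" and "G x = max (\<alpha> x) (\<beta> x)" for x
  have iso': "(\<Sum>x\<in>A. q x) \<le> (\<Sum>x\<in>A. \<Sum>y\<in>W - A. w' x y)"
    if "A \<noteq> {}" "A \<subseteq> {x\<in>W. r < (a x)\<^sup>2 \<or> r < (h x)\<^sup>2}" for A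
  proof -
    have "(\<Sum>x\<in>A. \<Sum>y\<in>W - A. w' x y) = (\<Sum>x\<in>A. \<Sum>y\<in>W - A. w x y)"
      by (intro sum.cong refl) (auto simp: w'_def)
    then show ?thesis using iso[OF that] by simp
  qed
  have 1: "(\<Sum>x\<in>W. q x * F x) \<le> (\<Sum>x\<in>W. \<Sum>y\<in>W. w' x y * \<bar>F x - F y\<bar>) / 2"
    by (intro coarea fin w'_sym iso') (auto simp: F_def \<alpha>_def \<beta>_def)
  have 2: "(\<Sum>x\<in>W. q x * G x) \<le> (\<Sum>x\<in>W. \<Sum>y\<in>W. w' x y * \<bar>G x - G y\<bar>) / 2"
    by (intro coarea fin w'_sym iso') (auto simp: G_def \<alpha>_def \<beta>_def)
  have "(\<Sum>x\<in>W. \<Sum>y\<in>W. w' x y * \<bar>F x - F y\<bar>) + (\<Sum>x\<in>W. \<Sum>y\<in>W. w' x y * \<bar>G x - G y\<bar>)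
      \<le> (\<Sum>x\<in>W. \<Sum>y\<in>W. w' x y * \<bar>(a x)\<^sup>2 - (h y)\<^sup>2\<bar>) + (\<Sum>x\<in>W. \<Sum>y\<in>W. w' x y * \<bar>(a y)\<^sup>2 - (h x)\<^sup>2\<bar>)"
    unfolding sum.distrib[symmetric] distrib_left[symmetric]
  proof (intro sum_mono mult_left_mono w'_nonneg)
    fix x y
    have "\<bar>F x - F y\<bar> + \<bar>G x - G y\<bar> \<le> \<bar>\<alpha> x - \<beta> y\<bar> + \<bar>\<alpha> y - \<beta> x\<bar>"
      unfolding F_def G_def by (rule abs_diff_min_max_le)
    also have "\<dots> \<le> \<bar>(a x)\<^sup>2 - (h y)\<^sup>2\<bar> + \<bar>(a y)\<^sup>2 - (h x)\<^sup>2\<bar>"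
      by (intro add_mono) (auto simp: \<alpha>_def \<beta>_def max_def abs_if)
    finally show "\<bar>F x - F y\<bar> + \<bar>G x - G y\<bar> \<le> \<bar>(a x)\<^sup>2 - (h y)\<^sup>2\<bar> + \<bar>(a y)\<^sup>2 - (h x)\<^sup>2\<bar>" .
  qed
  also have "(\<Sum>x\<in>W. \<Sum>y\<in>W. w' x y * \<bar>(a y)\<^sup>2 - (h x)\<^sup>2\<bar>) = (\<Sum>x\<in>W. \<Sum>y\<in>W. w' x y * \<bar>(a x)\<^sup>2 - (h y)\<^sup>2\<bar>)"
    by (subst sum.swap) (simp add: w'_sym)
  finally have 3: "(\<Sum>x\<in>W. \<Sum>y\<in>W. w' x y * \<bar>F x - F y\<bar>) + (\<Sum>x\<in>W. \<Sum>y\<in>W. w' x y * \<bar>G x - G y\<bar>)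
      \<le> 2 * (\<Sum>x\<in>W. \<Sum>y\<in>W. w' x y * \<bar>(a x)\<^sup>2 - (h y)\<^sup>2\<bar>)" by simp
  have "(\<Sum>x\<in>W. q x * (\<alpha> x + \<beta> x)) = (\<Sum>x\<in>W. q x * F x) + (\<Sum>x\<in>W. q x * G x)"
    unfolding sum.distrib[symmetric] distrib_left[symmetric]
    by (intro sum.cong refl) (auto simp: F_def G_def min_def max_def)
  then show ?thesis using 1 2 3 unfolding \<alpha>_def \<beta>_def by simp
qed

text \<open>With \<open>\<sigma> = 1 - \<gamma>\<close> and
  \<open>\<tau> = \<rho> - \<gamma>\<close> the hypotheses give
  \<open>s^2 + \<tau>^2 \<le> \<sigma>^2\<close>, hence also
  \<open>\<tau> \<le> \<sigma> - s^2 / (2 * \<sigma>)\<close>. In the expansion of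
  \<open>(\<tau> + \<gamma>)^2\<close> the square loses \<open>s^2\<close> and the linear term loses
  \<open>\<gamma> * s^2 / \<sigma>\<close>, which add up to \<open>s^2 / \<sigma>\<close>.\<close>

lemma contraction_factor_le:
  fixes \<rho> s z T S :: real
  assumes "\<gamma> \<le> \<rho>" "0 < z" "0 \<le> s" "2 * s * z \<le> S" "(\<rho> - \<gamma>) * z \<le> T"
    and S: "S\<^sup>2 \<le> 4 * (((1 - \<gamma>) * z)\<^sup>2 - T\<^sup>2)"
  shows "\<rho>\<^sup>2 \<le> 1 - s\<^sup>2 / (1 - \<gamma>)"
proof -
  define \<sigma> \<tau> where "\<sigma> = 1 - \<gamma>" and "\<tau> = \<rho> - \<gamma>"
  have \<sigma>: "0 < \<sigma>" and \<tau>: "0 \<le> \<tau>" using gamma assms by (auto simp: \<sigma>_def \<tau>_def)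
  have "(2 * s * z)\<^sup>2 \<le> S\<^sup>2" using assms by (intro power_mono) auto
  moreover have "(\<tau> * z)\<^sup>2 \<le> T\<^sup>2" using assms \<tau> by (intro power_mono) (auto simp: \<tau>_def)
  ultimately have "z\<^sup>2 * (s\<^sup>2 + \<tau>\<^sup>2) \<le> z\<^sup>2 * \<sigma>\<^sup>2"
    using S unfolding \<sigma>_def[symmetric] by (simp add: power_mult_distrib algebra_simps)
  then have le: "s\<^sup>2 + \<tau>\<^sup>2 \<le> \<sigma>\<^sup>2" using \<open>0 < z\<close> by simp
  have "\<tau>\<^sup>2 \<le> \<sigma>\<^sup>2" using le by (smt (verit) zero_le_power2)
  then have "\<tau> \<le> \<sigma>" using \<sigma> by (simp add: abs_le_square_iff[symmetric] \<tau>)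
  then have "(\<sigma> - \<tau>) * (\<sigma> + \<tau>) \<le> (\<sigma> - \<tau>) * (2 * \<sigma>)" by (intro mult_left_mono) auto
  then have "s\<^sup>2 \<le> (\<sigma> - \<tau>) * (2 * \<sigma>)" using le by (simp add: power2_eq_square algebra_simps)
  then have "s\<^sup>2 / (2 * \<sigma>) \<le> \<sigma> - \<tau>" using \<sigma> by (simp add: pos_divide_le_eq)
  then have "2 * \<gamma> * (s\<^sup>2 / (2 * \<sigma>)) \<le> 2 * \<gamma> * (\<sigma> - \<tau>)" using gamma by (intro mult_left_mono) auto
  moreover have "\<rho>\<^sup>2 = \<tau>\<^sup>2 + 2 * \<gamma> * \<tau> + \<gamma>\<^sup>2" by (simp add: \<tau>_def power2_eq_square algebra_simps)
  moreover have "1 = \<sigma>\<^sup>2 + 2 * \<gamma> * \<sigma> + \<gamma>\<^sup>2" by (simp add: \<sigma>_def power2_eq_square algebra_simps)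
  moreover have "s\<^sup>2 / \<sigma> = s\<^sup>2 + 2 * \<gamma> * (s\<^sup>2 / (2 * \<sigma>))"
    using \<sigma> by (simp add: \<sigma>_def field_simps)
  ultimately show ?thesis using le unfolding \<sigma>_def[symmetric] by (simp add: algebra_simps)
qed

text \<open>The function \<open>a\<close> is \<open>P h\<close>, rescaled to have the same energy as \<open>h\<close>.\<close>

lemma dual_function:
  assumes h: "\<And>x. x \<in> W \<Longrightarrow> 0 \<le> h x" "(\<Sum>x\<in>W. d x * h x) \<le> 1" and z: "0 < energy h"
  obtains a where "\<And>x. x \<in> W \<Longrightarrow> 0 \<le> a x" "(\<Sum>x\<in>W. d x * a x) \<le> 1 / \<gamma>"
    "energy a = energy h"
    "\<And>s. 0 \<le> s \<Longrightarrow> 2 * s * energy h \<le> (\<Sum>x\<in>W. \<Sum>y\<in>W. w' x y * \<bar>(a x)\<^sup>2 - (h y)\<^sup>2\<bar>)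
      \<Longrightarrow> energy (P h) \<le> energy h * (1 - s\<^sup>2 / (1 - \<gamma>))"
proof -
  define \<rho> where "\<rho> = sqrt (energy (P h) / energy h)"
  define a where "a x = P h x / \<rho>" for x
  have "\<gamma>\<^sup>2 * energy h \<le> energy (P h)"
    unfolding energy_def sum_distrib_left
  proof (rule sum_mono)
    fix x assume x: "x \<in> W"
    have "(\<gamma> * h x)\<^sup>2 \<le> (P h x)\<^sup>2"
      using P_ge[OF h(1) x] gamma h(1)[OF x] by (intro power_mono) auto
    then have "d x * (\<gamma> * h x)\<^sup>2 \<le> d x * (P h x)\<^sup>2"
      using d_pos[OF x] by (intro mult_left_mono) auto
    then show "\<gamma>\<^sup>2 * (d x * (h x)\<^sup>2) \<le> d x * (P h x)\<^sup>2"
      by (simp add: power_mult_distrib mult_ac)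
  qed
  then have "\<gamma>\<^sup>2 \<le> energy (P h) / energy h" using z by (simp add: field_simps)
  then have \<rho>: "\<gamma> \<le> \<rho>" unfolding \<rho>_def by (rule real_le_rsqrt)
  then have \<rho>0: "0 < \<rho>" using gamma by simp
  have \<rho>2: "\<rho>\<^sup>2 * energy h = energy (P h)"
    using z energy_nonneg[of "P h"] by (simp add: \<rho>_def)
  have a0: "0 \<le> a x" if "x \<in> W" for x
    using P_nonneg[OF h(1) that] \<rho>0 by (simp add: a_def)
  have "(\<Sum>x\<in>W. d x * a x) = (\<Sum>x\<in>W. d x * h x) / \<rho>"
    unfolding sum_d_P[of h, symmetric] by (simp add: a_def sum_divide_distrib)
  \<comment> \<open>By laziness \<open>\<rho> \<ge> \<gamma>\<close>, so the rescaling raises the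
    mass to at most \<open>1 / \<gamma>\<close>.\<close>
  also have "\<dots> \<le> 1 / \<gamma>" using h(2) \<rho> \<rho>0 gamma by (intro frac_le) auto
  finally have a1: "(\<Sum>x\<in>W. d x * a x) \<le> 1 / \<gamma>" .
  have "energy a = energy (P h) / \<rho>\<^sup>2"
    by (simp add: energy_def a_def power_divide sum_divide_distrib)
  then have ae: "energy a = energy h" unfolding \<rho>2[symmetric] using \<rho>0 by simp
  define T where "T = (\<Sum>x\<in>W. \<Sum>y\<in>W. w' x y * (a x * h y))"
  have "(\<Sum>x\<in>W. d x * (a x * h x)) \<le> (\<Sum>x\<in>W. d x * ((a x)\<^sup>2 / 2 + (h x)\<^sup>2 / 2))"
  proof (intro sum_mono mult_left_mono)
    fix x show "a x * h x \<le> (a x)\<^sup>2 / 2 + (h x)\<^sup>2 / 2"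
      using sum_squares_bound[of "a x" "h x"] by simp
  qed (use d_pos in \<open>auto intro: less_imp_le\<close>)
  also have "\<dots> = energy a / 2 + energy h / 2"
    by (simp add: energy_def sum.distrib distrib_left sum_divide_distrib)
  finally have ah: "(\<Sum>x\<in>W. d x * (a x * h x)) \<le> energy h" using ae by simp
  \<comment> \<open>Since \<open>P h\<close> is \<rho> times \<open>a\<close>, the full weights pair
    \<open>a\<close> with \<open>h\<close> to \<open>\<rho> * energy h\<close>. Replacing
    \<open>w\<close> by \<open>w'\<close> costs \<gamma> times the diagonal term, which
    \<open>ah\<close> bounds by the energy.\<close>
  have "(\<Sum>x\<in>W. \<Sum>y\<in>W. w x y * (a x * h y)) = (\<Sum>x\<in>W. d x * P h x * a x)"
    by (intro sum.cong refl) (simp add: d_P sum_distrib_left sum_distrib_right mult_ac)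
  also have "\<dots> = (\<Sum>x\<in>W. \<rho> * (d x * (a x)\<^sup>2))"
    using \<rho>0 by (intro sum.cong refl) (simp add: a_def power2_eq_square)
  also have "\<dots> = \<rho> * energy h"
    unfolding ae[symmetric] by (simp add: energy_def sum_distrib_left)
  finally have "T = \<rho> * energy h - \<gamma> * (\<Sum>x\<in>W. d x * (a x * h x))"
    unfolding T_def sum_w' by simp
  moreover have "\<gamma> * (\<Sum>x\<in>W. d x * (a x * h x)) \<le> \<gamma> * energy h"
    using ah gamma by (intro mult_left_mono) auto
  ultimately have T: "(\<rho> - \<gamma>) * energy h \<le> T"
    unfolding left_diff_distrib by linarith
  show thesis
  proof (rule that[of a])
    fix s :: real
    assume "0 \<le> s" "2 * s * energy h \<le> (\<Sum>x\<in>W. \<Sum>y\<in>W. w' x y * \<bar>(a x)\<^sup>2 - (h y)\<^sup>2\<bar>)"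
    then have "\<rho>\<^sup>2 \<le> 1 - s\<^sup>2 / (1 - \<gamma>)"
      using contraction_factor_le[OF \<rho> z _ _ T] variation_le[OF ae refl] by (auto simp: T_def)
    then show "energy (P h) \<le> energy h * (1 - s\<^sup>2 / (1 - \<gamma>))"
      unfolding \<rho>2[symmetric] using z by (simp add: mult.commute)
  qed (use a0 a1 ae in auto)
qed

text \<open>Both bounds come from \<open>variation_ge\<close>, with \<open>q\<close> equal to
  \<open>\<Phi> * d\<close> for the first and to the indicator of a maximum point of
  \<open>h\<close> for the second. The lower bound on the energy keeps the truncation error a small
  fraction of it.\<close>

lemma energy_step:
  assumes h: "\<And>x. x \<in> W \<Longrightarrow> 0 \<le> h x" "(\<Sum>x\<in>W. d x * h x) \<le> 1"
    and \<Phi>: "0 \<le> \<Phi>"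
      "\<And>A. A \<noteq> {} \<Longrightarrow> A \<subseteq> W \<Longrightarrow> sum d A \<le> v / 2 \<Longrightarrow> \<Phi> * sum d A \<le> (\<Sum>x\<in>A. \<Sum>y\<in>W - A. w x y)"
    and unit: "\<And>A. A \<noteq> {} \<Longrightarrow> A \<subseteq> W \<Longrightarrow> sum d A \<le> v / 2 \<Longrightarrow> 1 \<le> (\<Sum>x\<in>A. \<Sum>y\<in>W - A. w x y)"
    and v: "0 < v" and large: "8 / \<gamma> ^ 4 / v \<le> energy h"
  shows "energy (P h) \<le> energy h * exp (- (1 + \<gamma>) * \<Phi>\<^sup>2)"
    and "(energy (P h))\<^sup>2 * (1 + (energy h)\<^sup>2 / 16) \<le> (energy h)\<^sup>2"
proof -
  define z where "z = energy h"
  have z: "8 / \<gamma> ^ 4 / v \<le> z" "0 < z"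
  proof -
    show "8 / \<gamma> ^ 4 / v \<le> z" using large by (simp add: z_def)
    moreover have "0 < 8 / \<gamma> ^ 4 / v" using gamma v by simp
    ultimately show "0 < z" by linarith
  qed
  obtain a where a: "\<And>x. x \<in> W \<Longrightarrow> 0 \<le> a x" "(\<Sum>x\<in>W. d x * a x) \<le> 1 / \<gamma>" "energy a = z"
    and step: "\<And>s. 0 \<le> s \<Longrightarrow> 2 * s * z \<le> (\<Sum>x\<in>W. \<Sum>y\<in>W. w' x y * \<bar>(a x)\<^sup>2 - (h y)\<^sup>2\<bar>)
      \<Longrightarrow> energy (P h) \<le> z * (1 - s\<^sup>2 / (1 - \<gamma>))"
    using dual_function[OF h] z(2) unfolding z_def by blast
  define S where "S = (\<Sum>x\<in>W. \<Sum>y\<in>W. w' x y * \<bar>(a x)\<^sup>2 - (h y)\<^sup>2\<bar>)"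
  \<comment> \<open>Above this level \<open>a + h\<close> is at least \<open>r\<close>, while its
    total mass is at most \<open>2 / \<gamma>\<close>; the volume of such a set is therefore at most
    \<open>2 / (\<gamma> * r) = v / 2\<close>.\<close>
  define r where "r = 4 / (\<gamma> * v)"
  have r: "0 < r" using gamma v by (simp add: r_def)
  have small: "sum d A \<le> v / 2" "A \<subseteq> W" if A: "A \<subseteq> {x\<in>W. r\<^sup>2 < (a x)\<^sup>2 \<or> r\<^sup>2 < (h x)\<^sup>2}" for A
  proof -
    show "A \<subseteq> W" using A by auto
    have "r \<le> a x + h x" if "x \<in> A" for x
    proof -
      have "x \<in> W" and "r\<^sup>2 < (a x)\<^sup>2 \<or> r\<^sup>2 < (h x)\<^sup>2" using A that by auto
      then have "r < a x \<or> r < h x"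
        using a(1) h(1) by (meson power_less_imp_less_base)
      then show ?thesis using a(1)[OF \<open>x \<in> W\<close>] h(1)[OF \<open>x \<in> W\<close>] by auto
    qed
    then have "r * sum d A \<le> (\<Sum>x\<in>A. d x * (a x + h x))"
      unfolding sum_distrib_left using d_pos \<open>A \<subseteq> W\<close>
      by (intro sum_mono) (auto simp: mult.commute less_imp_le intro!: mult_left_mono)
    also have "\<dots> \<le> (\<Sum>x\<in>W. d x * (a x + h x))"
      using fin \<open>A \<subseteq> W\<close> a(1) h(1) d_pos
      by (intro sum_mono2) (auto intro!: mult_nonneg_nonneg add_nonneg_nonneg simp: less_imp_le)
    also have "\<dots> \<le> 1 / \<gamma> + 1" using a(2) h(2) by (simp add: distrib_left sum.distrib)
    also have "\<dots> \<le> 2 / \<gamma>" using gamma by (simp add: field_simps)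
    finally show "sum d A \<le> v / 2" using gamma v by (simp add: r_def field_simps)
  qed
  \<comment> \<open>Makes the truncation loss linear in \<open>u\<close>, so that the masses of
    \<open>a\<close> and \<open>h\<close> control it.\<close>
  have trunc: "u\<^sup>2 - r * u \<le> max 0 (u\<^sup>2 - r\<^sup>2)" if "0 \<le> u" for u
  proof (cases "r \<le> u")
    case True
    then have "r * r \<le> r * u" using r by (intro mult_left_mono) auto
    then show ?thesis by (auto simp: power2_eq_square)
  next
    case False
    then have "u * u \<le> r * u" using that by (intro mult_right_mono) auto
    then show ?thesis by (auto simp: power2_eq_square)
  qed

  \<comment> \<open>The fraction of \<open>2 * z\<close> that survives truncation. The threshold
    \<open>8 / \<gamma> ^ 4 / v\<close> is what yields
    \<open>\<kappa> \<ge> 1 - \<gamma>^2 / 2\<close>, hence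
    \<open>\<kappa>^2 \<ge> (1 + \<gamma>) * (1 - \<gamma>)\<close>; division by
    \<open>1 - \<gamma>\<close> then leaves the rate \<open>1 + \<gamma>\<close>.\<close>
  define \<kappa> where "\<kappa> = 1 - 4 / (\<gamma>\<^sup>2 * v * z)"
  have "(\<gamma>\<^sup>2 / 2) * (8 / \<gamma> ^ 4 / v) \<le> (\<gamma>\<^sup>2 / 2) * z"
    using z(1) by (rule mult_left_mono) simp
  moreover have "(\<gamma>\<^sup>2 / 2) * (8 / \<gamma> ^ 4 / v) = 4 / (\<gamma>\<^sup>2 * v)"
    using gamma v by (simp add: power_numeral_reduce)
  ultimately have "4 / (\<gamma>\<^sup>2 * v) \<le> (\<gamma>\<^sup>2 / 2) * z" by simp
  then have "4 / (\<gamma>\<^sup>2 * v) / z \<le> \<gamma>\<^sup>2 / 2"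
    unfolding pos_divide_le_eq[OF z(2)] .
  then have \<kappa>: "1 - \<gamma>\<^sup>2 / 2 \<le> \<kappa>" by (simp add: \<kappa>_def mult_ac)
  have \<gamma>2: "\<gamma>\<^sup>2 \<le> 1 / 4" using power_mono[of \<gamma> "1/2" 2] gamma by (simp add: power2_eq_square)
  have "(\<Sum>x\<in>W. d x * (((a x)\<^sup>2 - r * a x) + ((h x)\<^sup>2 - r * h x)))
      = energy a + energy h - r * ((\<Sum>x\<in>W. d x * a x) + (\<Sum>x\<in>W. d x * h x))"
    by (simp add: energy_def algebra_simps sum.distrib sum_subtractf sum_distrib_left)
  also have "\<dots> \<ge> 2 * z - r * (2 / \<gamma>)"
  proof -
    have "1 / \<gamma> + 1 \<le> 2 / \<gamma>" using gamma by (simp add: field_simps)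
    then have "r * ((\<Sum>x\<in>W. d x * a x) + (\<Sum>x\<in>W. d x * h x)) \<le> r * (2 / \<gamma>)"
      using a(2) h(2) r by (intro mult_left_mono) auto
    then show ?thesis using a(3) by (simp add: z_def)
  qed
  finally have low: "2 * z - r * (2 / \<gamma>) \<le> (\<Sum>x\<in>W. d x * (((a x)\<^sup>2 - r * a x) + ((h x)\<^sup>2 - r * h x)))" .
  have "2 * (\<Phi> * \<kappa>) * z = \<Phi> * (2 * z - r * (2 / \<gamma>))"
    using z gamma v by (simp add: \<kappa>_def r_def field_simps power2_eq_square)
  also have "\<dots> \<le> \<Phi> * (\<Sum>x\<in>W. d x * (((a x)\<^sup>2 - r * a x) + ((h x)\<^sup>2 - r * h x)))"
    using \<Phi>(1) low by (intro mult_left_mono) auto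
  also have "\<dots> \<le> \<Phi> * (\<Sum>x\<in>W. d x * (max 0 ((a x)\<^sup>2 - r\<^sup>2) + max 0 ((h x)\<^sup>2 - r\<^sup>2)))"
    using \<Phi>(1) d_pos a(1) h(1) by (intro mult_left_mono sum_mono add_mono trunc) (auto intro: less_imp_le)
  also have "\<dots> = (\<Sum>x\<in>W. (\<Phi> * d x) * (max 0 ((a x)\<^sup>2 - r\<^sup>2) + max 0 ((h x)\<^sup>2 - r\<^sup>2)))"
    by (simp add: sum_distrib_left mult.assoc)
  also have "\<dots> \<le> S"
    unfolding S_def
    by (rule variation_ge) (use \<Phi>(2) small in \<open>auto simp: sum_distrib_left[symmetric]\<close>)
  finally have "energy (P h) \<le> z * (1 - (\<Phi> * \<kappa>)\<^sup>2 / (1 - \<gamma>))"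
    using \<Phi>(1) \<kappa> \<gamma>2 by (intro step) (auto simp: S_def)
  also have "\<dots> \<le> z * exp (- (1 + \<gamma>) * \<Phi>\<^sup>2)"
  proof (intro mult_left_mono)
    have "(1 + \<gamma>) * (1 - \<gamma>) \<le> (1 - \<gamma>\<^sup>2 / 2)\<^sup>2"
      using gamma by (simp add: power2_eq_square algebra_simps)
    also have "\<dots> \<le> \<kappa>\<^sup>2" using \<kappa> \<gamma>2 by (intro power_mono) auto
    finally have "1 + \<gamma> \<le> \<kappa>\<^sup>2 / (1 - \<gamma>)" using gamma by (simp add: pos_le_divide_eq)
    then have "\<Phi>\<^sup>2 * (1 + \<gamma>) \<le> \<Phi>\<^sup>2 * (\<kappa>\<^sup>2 / (1 - \<gamma>))" by (intro mult_left_mono) auto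
    then have "1 - (\<Phi> * \<kappa>)\<^sup>2 / (1 - \<gamma>) \<le> 1 + - (1 + \<gamma>) * \<Phi>\<^sup>2"
      by (simp add: power_mult_distrib algebra_simps)
    also have "\<dots> \<le> exp (- (1 + \<gamma>) * \<Phi>\<^sup>2)" by (rule exp_ge_add_one_self)
    finally show "1 - (\<Phi> * \<kappa>)\<^sup>2 / (1 - \<gamma>) \<le> exp (- (1 + \<gamma>) * \<Phi>\<^sup>2)" .
  qed (use z in auto)
  finally show "energy (P h) \<le> energy h * exp (- (1 + \<gamma>) * \<Phi>\<^sup>2)" by (simp add: z_def)

  \<comment> \<open>Second bound: the energy is at most the maximum of \<open>h\<close> times its
    mass, so \<open>h\<close> reaches \<open>z\<close> at some vertex. As every relevant level set
    has at least one boundary edge, this single value forces a variation of order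
    \<open>z^2\<close>.\<close>
  have "W \<noteq> {}" using v by (auto simp: v_def)
  then have "Max (h ` W) \<in> h ` W" using fin by (intro Max_in) auto
  then obtain x1 where x1: "x1 \<in> W" "h x1 = Max (h ` W)" by auto
  have "z = (\<Sum>x\<in>W. (d x * h x) * h x)" by (simp add: z_def energy_def power2_eq_square mult.assoc)
  also have "\<dots> \<le> (\<Sum>x\<in>W. (d x * h x) * h x1)"
    using fin h(1) d_pos x1(2) by (intro sum_mono mult_left_mono) (auto simp: less_imp_le)
  also have "\<dots> \<le> 1 * h x1"
    unfolding sum_distrib_right[symmetric] using h(2) h(1)[OF x1(1)] by (rule mult_right_mono)
  finally have x1: "x1 \<in> W" "z \<le> h x1" using x1 by auto
  have r2z: "2 * r \<le> z"
  proof -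
    have "\<gamma> ^ 4 \<le> \<gamma> ^ 1" using gamma by (intro power_decreasing) auto
    then have "8 / \<gamma> / v \<le> 8 / \<gamma> ^ 4 / v" using gamma v by (intro divide_right_mono divide_left_mono) auto
    then show ?thesis using z(1) by (simp add: r_def)
  qed
  have "(\<Sum>x\<in>W. of_bool (x = x1) * (max 0 ((a x)\<^sup>2 - r\<^sup>2) + max 0 ((h x)\<^sup>2 - r\<^sup>2))) \<le> S"
    unfolding S_def
  proof (rule variation_ge)
    fix A assume A: "A \<noteq> {}" "A \<subseteq> {x\<in>W. r\<^sup>2 < (a x)\<^sup>2 \<or> r\<^sup>2 < (h x)\<^sup>2}"
    have "finite A" using small(2)[OF A(2)] fin finite_subset by blast
    then have "(\<Sum>x\<in>A. of_bool (x = x1)) \<le> (1 :: real)"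
      by (simp add: of_bool_def)
    also have "\<dots> \<le> (\<Sum>x\<in>A. \<Sum>y\<in>W - A. w x y)" using unit A small by auto
    finally show "(\<Sum>x\<in>A. of_bool (x = x1)) \<le> (\<Sum>x\<in>A. \<Sum>y\<in>W - A. w x y)" .
  qed simp
  also have "(\<Sum>x\<in>W. of_bool (x = x1) * (max 0 ((a x)\<^sup>2 - r\<^sup>2) + max 0 ((h x)\<^sup>2 - r\<^sup>2)))
      = max 0 ((a x1)\<^sup>2 - r\<^sup>2) + max 0 ((h x1)\<^sup>2 - r\<^sup>2)"
    using x1 fin by (simp add: of_bool_def if_distrib if_distribR cong: if_cong)
  finally have "(h x1)\<^sup>2 - r\<^sup>2 \<le> S" by linarith
  moreover have "z\<^sup>2 \<le> (h x1)\<^sup>2" using x1 z by (intro power_mono) auto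
  moreover have "(2 * r)\<^sup>2 \<le> z\<^sup>2" using r2z r by (intro power_mono) auto
  moreover have "(2 * r)\<^sup>2 = 4 * r\<^sup>2" "2 * (z / 4) * z = z\<^sup>2 / 2" by (auto simp: power2_eq_square)
  moreover have "0 \<le> z\<^sup>2" by simp
  ultimately have "2 * (z / 4) * z \<le> S" by linarith
  then have "energy (P h) \<le> z * (1 - (z / 4)\<^sup>2 / (1 - \<gamma>))"
    using z by (intro step) (auto simp: S_def)
  also have "\<dots> \<le> z * (1 - z\<^sup>2 / 16)"
  proof (intro mult_left_mono)
    have "(z / 4)\<^sup>2 / 1 \<le> (z / 4)\<^sup>2 / (1 - \<gamma>)" using gamma by (intro divide_left_mono) auto
    then show "1 - (z / 4)\<^sup>2 / (1 - \<gamma>) \<le> 1 - z\<^sup>2 / 16" by (simp add: power_divide)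
  qed (use z in auto)
  finally have le: "energy (P h) \<le> z * (1 - z\<^sup>2 / 16)" .
  \<comment> \<open>The squared form rests on \<open>(1 - y)^2 * (1 + y) \<le> 1\<close>; under
    iteration it lets reciprocals of squared energies be added up.\<close>
  define y where "y = z\<^sup>2 / 16"
  have "0 \<le> z * (1 - y)" using le energy_nonneg[of "P h"] by (simp add: y_def)
  then have y: "0 \<le> y" "y \<le> 1" using z by (auto simp: y_def zero_le_mult_iff)
  have "(energy (P h))\<^sup>2 * (1 + y) \<le> (z * (1 - y))\<^sup>2 * (1 + y)"
    using le energy_nonneg[of "P h"] y by (intro mult_right_mono power_mono) (auto simp: y_def)
  also have "\<dots> = z\<^sup>2 * ((1 - y) * (1 - y * y))" by (simp add: power2_eq_square algebra_simps)
  also have "\<dots> \<le> z\<^sup>2 * 1"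
    using y by (intro mult_left_mono mult_le_one) (auto simp: mult_le_one)
  finally show "(energy (P h))\<^sup>2 * (1 + (energy h)\<^sup>2 / 16) \<le> (energy h)\<^sup>2"
    by (simp add: y_def z_def)
qed

end

section \<open>Summability of a doubly contracted sequence\<close>

text \<open>In reciprocals the contraction says that \<open>1 / z^2\<close> grows by at least
  \<open>1 / 16\<close> per step, so squares decay like \<open>16 / k\<close>. The summand
  \<open>2 * K^2\<close> absorbs the steps at which only the floor is known.\<close>

lemma nash_iteration:
  fixes z :: "nat \<Rightarrow> real"
  assumes nn: "\<And>k. k \<le> n \<Longrightarrow> 0 \<le> z k" and z0: "z 0 \<le> 1"
    and step: "\<And>k. k < n \<Longrightarrow> z (Suc k) \<le> K / real (Suc k) \<or> (z (Suc k))\<^sup>2 * (1 + (z k)\<^sup>2 / 16) \<le> (z k)\<^sup>2"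
    and "k \<le> n"
  shows "(z k)\<^sup>2 * real (Suc k) \<le> 16 + 2 * K\<^sup>2"
  using \<open>k \<le> n\<close>
proof (induction k)
  case 0
  have "(z 0)\<^sup>2 \<le> 1" using nn[of 0] z0 by (simp add: power_le_one)
  also have "\<dots> \<le> 16 + 2 * K\<^sup>2" by simp
  finally show ?case by simp
next
  case (Suc k)
  define Q where "Q = 16 + 2 * K\<^sup>2"
  have IH: "(z k)\<^sup>2 * real (Suc k) \<le> Q" using Suc by (simp add: Q_def)
  consider "z (Suc k) \<le> K / real (Suc k)" | "(z (Suc k))\<^sup>2 * (1 + (z k)\<^sup>2 / 16) \<le> (z k)\<^sup>2"
    using step[of k] Suc.prems by auto
  then show ?case
  proof cases
    case 1
    then have "(z (Suc k))\<^sup>2 \<le> (K / real (Suc k))\<^sup>2" using nn[of "Suc k"] Suc.prems by (intro power_mono) auto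
    then have "(z (Suc k))\<^sup>2 * real (Suc (Suc k)) \<le> (K / real (Suc k))\<^sup>2 * (2 * real (Suc k))"
      by (intro mult_mono) auto
    also have "\<dots> = 2 * K\<^sup>2 / real (Suc k)"
      unfolding power_divide power2_eq_square[of "real (Suc k)"] by (simp del: of_nat_Suc)
    also have "\<dots> \<le> 2 * K\<^sup>2 / 1" by (intro divide_left_mono) auto
    also have "\<dots> \<le> 16 + 2 * K\<^sup>2" by simp
    finally show ?thesis .
  next
    case 2
    define y y' where "y = (z k)\<^sup>2" and "y' = (z (Suc k))\<^sup>2"
    have "y' * (16 + y) \<le> 16 * y" using 2 by (simp add: y_def y'_def algebra_simps)
    then have "y' * (16 + y) * real (Suc (Suc k)) \<le> 16 * y * real (Suc (Suc k))"
      by (rule mult_right_mono) simp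
    also have "\<dots> = 16 * (y * real (Suc k)) + 16 * y" by (simp add: algebra_simps)
    also have "\<dots> \<le> 16 * Q + Q * y" using IH by (intro add_mono mult_right_mono) (auto simp: y_def Q_def)
    also have "\<dots> = Q * (16 + y)" by (simp add: algebra_simps)
    finally have "(y' * real (Suc (Suc k))) * (16 + y) \<le> Q * (16 + y)" by (simp add: mult_ac)
    then have "y' * real (Suc (Suc k)) \<le> Q"
      by (rule mult_right_le_imp_le) (simp add: y_def add_pos_nonneg)
    then show ?thesis by (simp add: y'_def Q_def)
  qed
qed

text \<open>\<open>a\<close> decreases forwards and \<open>b\<close> decreases backwards, each until it reaches \<open>\<kappa>\<close>. Either some
  intermediate time has both below \<open>\<kappa>\<close>, or at some time the two contractions together cover the
  whole interval.\<close>

lemma meeting_time: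
  fixes a b m :: "nat \<Rightarrow> real"
  assumes "s0 \<le> s1" and "\<And>s. 0 \<le> a s" "\<And>s. 0 \<le> b s"
    and "\<And>s. s0 \<le> s \<Longrightarrow> s < s1 \<Longrightarrow> a s \<le> \<kappa> \<or> a (Suc s) \<le> a s * exp (- c * m s)"
    and "\<And>s. s0 \<le> s \<Longrightarrow> s < s1 \<Longrightarrow> b s \<le> \<kappa> \<or> b s \<le> b (Suc s) * exp (- c * m s)"
    and "\<And>s. s0 \<le> s \<Longrightarrow> s < s1 \<Longrightarrow> b s \<le> b (Suc s)"
  shows "\<exists>s. s0 \<le> s \<and> s \<le> s1 \<and> (a s * b s \<le> \<kappa>\<^sup>2 \<or> a s * b s \<le> a s0 * b s1 * exp (- c * (\<Sum>u=s0..<s1. m u)))"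
  using assms
proof (induction "s1 - s0" arbitrary: s0 s1)
  case 0
  then show ?case by auto
next
  case (Suc n)
  note mono = Suc.prems(6)
  have lt: "s0 < s1" using Suc.hyps(2) by simp
  then obtain s2 where s2: "s1 = Suc s2" by (cases s1) auto
  \<comment> \<open>The interval is shortened on the left if \<open>a\<close> contracts at its first
    step and on the right if \<open>b\<close> contracts at its last; a time found for the shorter
    interval serves the longer one.\<close>
  consider "a (Suc s0) \<le> a s0 * exp (- c * m s0)" | "b s2 \<le> b s1 * exp (- c * m s2)" | "a s0 \<le> \<kappa>" "b s2 \<le> \<kappa>"
    using Suc.prems(4)[of s0] Suc.prems(5)[of s2] lt s2 by auto
  then show ?case
  proof cases
    case 1
    have "\<exists>s. Suc s0 \<le> s \<and> s \<le> s1 \<and>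
        (a s * b s \<le> \<kappa>\<^sup>2 \<or> a s * b s \<le> a (Suc s0) * b s1 * exp (- c * (\<Sum>u=Suc s0..<s1. m u)))"
      by (rule Suc.hyps(1)) (use Suc.hyps(2) Suc.prems lt in auto)
    then obtain s where s: "Suc s0 \<le> s" "s \<le> s1"
      "a s * b s \<le> \<kappa>\<^sup>2 \<or> a s * b s \<le> a (Suc s0) * b s1 * exp (- c * (\<Sum>u=Suc s0..<s1. m u))" by blast
    have "a (Suc s0) * b s1 * exp (- c * (\<Sum>u=Suc s0..<s1. m u))
        \<le> a s0 * exp (- c * m s0) * b s1 * exp (- c * (\<Sum>u=Suc s0..<s1. m u))"
      by (intro mult_right_mono 1 Suc.prems(3)) simp
    also have "\<dots> = a s0 * b s1 * exp (- c * (\<Sum>u=s0..<s1. m u))"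
      unfolding sum.atLeast_Suc_lessThan[OF lt] distrib_left exp_add by (simp only: mult_ac)
    finally show ?thesis using s by (intro exI[of _ s]) auto
  next
    case 2
    have "\<exists>s. s0 \<le> s \<and> s \<le> s2 \<and>
        (a s * b s \<le> \<kappa>\<^sup>2 \<or> a s * b s \<le> a s0 * b s2 * exp (- c * (\<Sum>u=s0..<s2. m u)))"
      by (rule Suc.hyps(1)) (use Suc.hyps(2) Suc.prems lt s2 in auto)
    then obtain s where s: "s0 \<le> s" "s \<le> s2"
      "a s * b s \<le> \<kappa>\<^sup>2 \<or> a s * b s \<le> a s0 * b s2 * exp (- c * (\<Sum>u=s0..<s2. m u))" by blast
    have "a s0 * b s2 * exp (- c * (\<Sum>u=s0..<s2. m u))
        \<le> a s0 * (b s1 * exp (- c * m s2)) * exp (- c * (\<Sum>u=s0..<s2. m u))"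
      by (intro mult_right_mono mult_left_mono 2 Suc.prems(2)) simp
    also have "\<dots> = a s0 * b s1 * exp (- c * (\<Sum>u=s0..<s1. m u))"
    proof -
      have "(\<Sum>u=s0..<s1. m u) = (\<Sum>u=s0..<s2. m u) + m s2" using lt s2 by simp
      then show ?thesis unfolding distrib_left by (simp only: exp_add distrib_left mult_ac)
    qed
    finally show ?thesis using s s2 by (intro exI[of _ s]) auto
  next
    case 3
    \<comment> \<open>As \<open>b\<close> increases with time, the bound by \<kappa> at
      \<open>s2\<close> passes to \<open>s0\<close>, which then has both values below
      \<kappa>.\<close>
    have "s0 + k \<le> s2 \<Longrightarrow> b s0 \<le> b (s0 + k)" for k
    proof (induction k)
      case (Suc k)
      then have "b s0 \<le> b (s0 + k)" by simp
      also have "\<dots> \<le> b (Suc (s0 + k))" using Suc.prems s2 by (intro mono) auto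
      finally show ?case by simp
    qed simp
    from this[of "s2 - s0"] have "b s0 \<le> b s2" using lt s2 by simp
    then have "a s0 * b s0 \<le> \<kappa> * \<kappa>"
      using 3 Suc.prems(2)[of s0] Suc.prems(3)[of s0] by (intro mult_mono) auto
    then show ?thesis using lt by (auto simp: power2_eq_square intro!: exI[of _ s0])
  qed
qed

section \<open>Dyadic blocks and windows of negligible exponent\<close>

lemma summable_dyadic:
  fixes f c :: "nat \<Rightarrow> real"
  assumes "\<And>t. 0 \<le> f t" "\<And>j. (\<Sum>t=2^j..<2^Suc j. f t) \<le> c j" "summable c"
  shows "summable f"
proof (rule summableI_nonneg_bounded)
  have c: "0 \<le> c j" for j
    using assms(2)[of j] sum_nonneg[of "{2^j..<2^Suc j}" f] assms(1) by force
  have 1: "(\<Sum>t=1..<2^J. f t) \<le> (\<Sum>j<J. c j)" for J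
  proof (induction J)
    case (Suc J)
    have "(\<Sum>t=1..<2^Suc J. f t) = (\<Sum>t=1..<2^J. f t) + (\<Sum>t=2^J..<2^Suc J. f t)"
      by (rule sum.atLeastLessThan_concat[symmetric]) auto
    then show ?case using Suc assms(2)[of J] by simp
  qed simp
  fix n
  have "(\<Sum>t<n. f t) \<le> (\<Sum>t\<in>insert 0 {1..<2^n}. f t)"
  proof (rule sum_mono2)
    show "{..<n} \<subseteq> insert 0 {1..<2 ^ n}"
      using less_trans[OF _ less_exp[of n]] by auto
  qed (use assms(1) in auto)
  also have "\<dots> = f 0 + (\<Sum>t=1..<2^n. f t)" by simp
  also have "\<dots> \<le> f 0 + (\<Sum>j. c j)"
    using 1[of n] sum_le_suminf[OF assms(3), of "{..<n}"] c by force
  finally show "(\<Sum>t<n. f t) \<le> f 0 + (\<Sum>j. c j)" .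
qed (use assms in auto)

text \<open>\<open>L\<close> is one less than the first length at which the window before
  \<open>t\<close> carries more than \<open>\<eta> * ln t\<close>, or the whole half if there is
  none. In the first case \<open>t - u \<le> Suc L\<close> throughout the overfull window, so its
  mass reappears in the weighted sum, divided by at most \<open>sqrt (Suc L)\<close>; in the second
  \<open>Suc L \<ge> t / 2\<close>.\<close>

lemma choose_window:
  fixes m :: "nat \<Rightarrow> real"
  assumes m: "\<And>u. 0 \<le> m u" and \<eta>: "0 < \<eta>" and t: "2 \<le> t"
  obtains L where "L \<le> t - t div 2" "(\<Sum>u=t-L..<t. m u) \<le> \<eta> * ln t"
    "1 / sqrt (real (Suc L)) \<le> sqrt 2 / sqrt t + (\<Sum>u=t div 2..<t. m u / sqrt (real (t - u))) / (\<eta> * ln t)"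
proof -
  define R where "R L \<longleftrightarrow> L \<le> t - t div 2 \<and> \<eta> * ln t < (\<Sum>u=t-L..<t. m u)" for L
  have lnt: "0 < \<eta> * ln t" using \<eta> t by simp
  have W: "0 \<le> (\<Sum>u=t div 2..<t. m u / sqrt (real (t - u))) / (\<eta> * ln t)"
    using m lnt by (intro divide_nonneg_pos sum_nonneg) auto
  show thesis
  proof (cases "\<exists>L. R L")
    case True
    define L where "L = (LEAST L. R L)"
    have L: "R L" unfolding L_def using True by (rule LeastI_ex)
    have "L \<noteq> 0"
    proof
      assume "L = 0"
      then have "\<eta> * ln t < 0" using L by (simp add: R_def)
      then show False using lnt by linarith
    qed
    then obtain L' where L': "L = Suc L'" by (cases L) auto
    have "\<not> R L'" unfolding L' using not_less_Least[of L' R] L' by (simp add: L_def)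
    then have "(\<Sum>u=t-L'..<t. m u) \<le> \<eta> * ln t" using L L' by (auto simp: R_def)
    moreover have W': "1 / sqrt (real L) \<le> (\<Sum>u=t div 2..<t. m u / sqrt (real (t - u))) / (\<eta> * ln t)"
    proof -
      have "1 / sqrt (real L) * (\<eta> * ln t) \<le> 1 / sqrt (real L) * (\<Sum>u=t-L..<t. m u)"
        using L by (intro mult_left_mono) (auto simp: R_def)
      also have "\<dots> = (\<Sum>u=t-L..<t. m u / sqrt (real L))" by (simp add: sum_distrib_left)
      also have "\<dots> \<le> (\<Sum>u=t-L..<t. m u / sqrt (real (t - u)))"
        using m by (intro sum_mono divide_left_mono) auto
      also have "\<dots> \<le> (\<Sum>u=t div 2..<t. m u / sqrt (real (t - u)))"
        using L m by (intro sum_mono2) (auto simp: R_def)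
      finally show ?thesis using lnt by (simp add: pos_le_divide_eq)
    qed
    moreover have "L' \<le> t - t div 2" using L L' by (simp add: R_def)
    moreover have "0 \<le> sqrt 2 / sqrt t" by simp
    then have "1 / sqrt (real L) \<le> sqrt 2 / sqrt t + (\<Sum>u=t div 2..<t. m u / sqrt (real (t - u))) / (\<eta> * ln t)"
      using W' by linarith
    ultimately show thesis unfolding L' by (intro that)
  next
    case False
    have "t \<le> 2 * Suc (t - t div 2)" by presburger
    then have "real t \<le> 2 * real (Suc (t - t div 2))" by linarith
    then have "sqrt t \<le> sqrt 2 * sqrt (real (Suc (t - t div 2)))"
      unfolding real_sqrt_mult[symmetric] by (rule real_sqrt_le_mono)
    then have "1 / sqrt (real (Suc (t - t div 2))) \<le> sqrt 2 / sqrt t" using t by (simp add: field_simps)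
    then have "1 / sqrt (real (Suc (t - t div 2)))
        \<le> sqrt 2 / sqrt t + (\<Sum>u=t div 2..<t. m u / sqrt (real (t - u))) / (\<eta> * ln t)"
      using W by linarith
    moreover have "(\<Sum>u=t - (t - t div 2)..<t. m u) \<le> \<eta> * ln t"
      using False unfolding R_def by (metis le_refl not_less)
    ultimately show thesis by (intro that[of "t - t div 2"]) auto
  qed
qed

lemma sum_inverse_sqrt_le: "(\<Sum>k=1..n. 1 / sqrt (real k)) \<le> 2 * sqrt n"
proof (induction n)
  case (Suc n)
  have "sqrt n \<le> sqrt (Suc n)" by simp
  then have "1 = (sqrt (Suc n) - sqrt n) * (sqrt (Suc n) + sqrt n)" by (simp add: algebra_simps)
  also have "\<dots> \<le> (sqrt (Suc n) - sqrt n) * (2 * sqrt (Suc n))" by (intro mult_left_mono) auto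
  finally have "1 / sqrt (Suc n) \<le> 2 * sqrt (Suc n) - 2 * sqrt n" by (simp add: field_simps)
  then show ?case using Suc by simp
qed simp

text \<open>This is the sense in which short windows are rare on average. After exchanging the sums,
  each \<open>u\<close> meets a sum of inverse square roots of order \<open>sqrt (2 ^ j)\<close>,
  and the total of \<open>m\<close> over the block is only logarithmic.\<close>

lemma block_sum_le:
  fixes m :: "nat \<Rightarrow> real"
  assumes m: "\<And>u. 0 \<le> m u" and G: "\<And>t. t \<in> G \<Longrightarrow> (\<Sum>u=t div 2..<t. m u) \<le> 4 * ln t"
  shows "(\<Sum>t\<in>{2^j..<2^Suc j} \<inter> G. \<Sum>u=t div 2..<t. m u / sqrt (real (t - u))) \<le> 32 * real (Suc j) * sqrt (2^j)"
proof (cases "{2^j..<2^Suc j} \<inter> G = {}")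
  case True
  then show ?thesis by simp
next
  case False
  define B where "B = {2^j..<2^Suc j} \<inter> G"
  define N :: nat where "N = 2 ^ Suc j"
  have fin: "finite B" by (simp add: B_def)
  have B: "t < N" "t div 2 < 2 ^ j" "2 ^ j \<le> t" "t \<in> G" if "t \<in> B" for t
    using that by (auto simp: B_def N_def)
  define t1 t2 where "t1 = Min B" and "t2 = Max B"
  have "B \<noteq> {}" using False by (simp add: B_def)
  then have mm: "t1 \<in> B" "t2 \<in> B" using fin unfolding t1_def t2_def by auto
  have le: "t1 \<le> t" "t \<le> t2" if "t \<in> B" for t using fin that by (auto simp: t1_def t2_def)
  define U where "U = {t1 div 2..<t2}"
  have "(\<Sum>t\<in>B. \<Sum>u=t div 2..<t. m u / sqrt (real (t - u)))
      \<le> (\<Sum>t\<in>B. \<Sum>u\<in>U. if u < t then m u / sqrt (real (t - u)) else 0)"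
  proof (rule sum_mono)
    fix t assume t: "t \<in> B"
    have "(\<Sum>u=t div 2..<t. m u / sqrt (real (t - u))) = (\<Sum>u=t div 2..<t. if u < t then m u / sqrt (real (t - u)) else 0)"
      by (intro sum.cong) auto
    also have "\<dots> \<le> (\<Sum>u\<in>U. if u < t then m u / sqrt (real (t - u)) else 0)"
      using le[OF t] m by (intro sum_mono2) (auto simp: U_def intro: order_trans[OF div_le_mono])
    finally show "(\<Sum>u=t div 2..<t. m u / sqrt (real (t - u))) \<le> (\<Sum>u\<in>U. if u < t then m u / sqrt (real (t - u)) else 0)" .
  qed
  also have "\<dots> = (\<Sum>u\<in>U. m u * (\<Sum>t\<in>B. if u < t then 1 / sqrt (real (t - u)) else 0))"
    by (subst sum.swap) (auto intro!: sum.cong simp: sum_distrib_left)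
  also have "\<dots> \<le> (\<Sum>u\<in>U. m u * (2 * sqrt N))"
  proof (intro sum_mono mult_left_mono m)
    fix u
    have "(\<Sum>t\<in>B. if u < t then 1 / sqrt (real (t - u)) else 0) = (\<Sum>t\<in>{t\<in>B. u < t}. 1 / sqrt (real (t - u)))"
      using fin by (simp add: sum.If_cases Int_def)
    also have "\<dots> = (\<Sum>k\<in>(\<lambda>t. t - u) ` {t\<in>B. u < t}. 1 / sqrt (real k))"
      by (subst sum.reindex) (auto simp: inj_on_def)
    also have "\<dots> \<le> (\<Sum>k=1..N. 1 / sqrt (real k))"
      using B(1) by (intro sum_mono2) (auto simp: Suc_le_eq dest!: B(1))
    also have "\<dots> \<le> 2 * sqrt N" by (rule sum_inverse_sqrt_le)
    finally show "(\<Sum>t\<in>B. if u < t then 1 / sqrt (real (t - u)) else 0) \<le> 2 * sqrt N" .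
  qed
  also have "\<dots> = (\<Sum>u\<in>U. m u) * (2 * sqrt N)" by (simp add: sum_distrib_right)
  also have "\<dots> \<le> (8 * ln N) * (2 * sqrt N)"
  proof (intro mult_right_mono)
    \<comment> \<open>The half-windows of the first and last good time leave no gap, so two
      applications of \<open>G\<close> cover all of \<open>U\<close>.\<close>
    have "t2 div 2 \<le> t1" using B(2)[OF mm(2)] B(3)[OF mm(1)] by simp
    then have "U \<subseteq> {t1 div 2..<t1} \<union> {t2 div 2..<t2}" by (auto simp: U_def)
    then have "(\<Sum>u\<in>U. m u) \<le> (\<Sum>u\<in>{t1 div 2..<t1} \<union> {t2 div 2..<t2}. m u)"
      using m by (intro sum_mono2) auto
    also have "\<dots> \<le> (\<Sum>u=t1 div 2..<t1. m u) + (\<Sum>u=t2 div 2..<t2. m u)"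
      using m sum_nonneg[of "{t1 div 2..<t1} \<inter> {t2 div 2..<t2}" m] by (subst sum_Un) auto
    also have "\<dots> \<le> 4 * ln t1 + 4 * ln t2" using mm B(4) by (intro add_mono G) auto
    also have "\<dots> \<le> 4 * ln N + 4 * ln N"
    proof -
      have "0 < t" if "t \<in> B" for t using B(3)[OF that] by (metis less_le_trans zero_less_numeral zero_less_power)
      then have "ln t \<le> ln N" if "t \<in> B" for t using that B(1)[OF that] by (simp add: less_imp_le)
      from this[OF mm(1)] this[OF mm(2)] show ?thesis by linarith
    qed
    finally show "(\<Sum>u\<in>U. m u) \<le> 8 * ln N" by simp
  qed simp
  also have "\<dots> \<le> (8 * real (Suc j)) * (2 * (2 * sqrt (2 ^ j)))"
  proof (rule mult_mono)
    have "ln N = real (Suc j) * ln 2" unfolding N_def of_nat_power of_nat_numeral by (rule ln_realpow)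
    also have "\<dots> \<le> real (Suc j) * 1" using ln_2_less_1 by (intro mult_left_mono) auto
    finally show "8 * ln N \<le> 8 * real (Suc j)" by simp
    have "sqrt 2 \<le> 2" by (simp add: real_le_lsqrt)
    then show "2 * sqrt N \<le> 2 * (2 * sqrt (2 ^ j))"
      by (simp add: N_def real_sqrt_mult)
  qed (auto simp: N_def)
  also have "\<dots> = 32 * real (Suc j) * sqrt (2 ^ j)" by simp
  finally show ?thesis by (simp only: B_def)
qed

text \<open>Young's inequality without constants: whichever of \<open>x\<close> and
  \<open>y powr (1 - \<theta>)\<close> is larger, the product is at most the corresponding
  summand.\<close>

lemma mult_powr_le:
  fixes x y \<theta> :: real
  assumes "0 \<le> x" "0 < y" "0 < \<theta>" "\<theta> < 1"
  shows "x * y powr \<theta> \<le> y + x powr (1 / (1 - \<theta>))"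
proof (cases "x \<le> y powr (1 - \<theta>)")
  case True
  then have "x * y powr \<theta> \<le> y powr (1 - \<theta>) * y powr \<theta>" by (intro mult_right_mono) auto
  also have "\<dots> = y" using assms by (simp flip: powr_add)
  finally show ?thesis by (simp add: add_increasing2)
next
  case False
  then have "(y powr (1 - \<theta>)) powr (\<theta> / (1 - \<theta>)) \<le> x powr (\<theta> / (1 - \<theta>))"
    using assms by (intro powr_mono2) auto
  then have "x * y powr \<theta> \<le> x * x powr (\<theta> / (1 - \<theta>))"
    using assms by (intro mult_left_mono) (auto simp: powr_powr)
  also have "\<dots> = x powr (1 + \<theta> / (1 - \<theta>))"
    using assms False by (cases "x = 0") (auto simp: powr_add)
  also have "1 + \<theta> / (1 - \<theta>) = 1 / (1 - \<theta>)" using assms by (simp add: field_simps)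
  finally show ?thesis using assms by simp
qed

lemma summable_div2:
  fixes f :: "nat \<Rightarrow> real"
  assumes "summable f" "\<And>t. 0 \<le> f t"
  shows "summable (\<lambda>t. f (t div 2))"
proof (rule summableI_nonneg_bounded)
  fix n
  have 1: "(\<Sum>t<2*k. f (t div 2)) = 2 * (\<Sum>t<k. f t)" for k
    by (induction k) auto
  have "(\<Sum>t<n. f (t div 2)) \<le> (\<Sum>t<2*n. f (t div 2))" using assms by (intro sum_mono2) auto
  also have "\<dots> \<le> 2 * (\<Sum>t. f t)" unfolding 1 using assms sum_le_suminf[of f "{..<n}"] by auto
  finally show "(\<Sum>t<n. f (t div 2)) \<le> 2 * (\<Sum>t. f t)" .
qed (use assms in auto)

text \<open>The terms of a summable decreasing sequence are of order \<open>1 / t\<close>, since all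
  of the first \<open>Suc t\<close> terms are at least the last of them.\<close>

lemma volume_linear_growth:
  fixes v :: "nat \<Rightarrow> real"
  assumes v: "\<And>t. 1 \<le> v t" "\<And>s t. s \<le> t \<Longrightarrow> v s \<le> v t" and sum: "summable (\<lambda>t. 1 / v t)"
  obtains C where "0 < C" "\<And>t. 1 / v t \<le> C / real (Suc t)"
proof
  show "0 < (\<Sum>t. 1 / v t)"
    using v sum by (intro suminf_pos) (auto simp: less_le_trans[OF zero_less_one])
  fix t
  have pos: "0 < v t" for t using v(1)[of t] by linarith
  have "real (Suc t) * (1 / v t) = (\<Sum>s<Suc t. 1 / v t)" by simp
  also have "\<dots> \<le> (\<Sum>s<Suc t. 1 / v s)"
    using v(2) pos by (intro sum_mono divide_left_mono) (auto intro: less_imp_le mult_pos_pos)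
  also have "\<dots> \<le> (\<Sum>t. 1 / v t)" using sum pos by (intro sum_le_suminf) (auto simp: less_imp_le)
  finally show "1 / v t \<le> (\<Sum>t. 1 / v t) / real (Suc t)" by (simp add: field_simps)
qed

text \<open>In the block of \<open>2 ^ j\<close> the power of \<open>t\<close> cancels the
  \<open>sqrt (2 ^ j)\<close> of \<open>block_sum_le\<close> and leaves \<open>Suc j * q ^ j\<close>
  with \<open>q = 2 powr (- \<delta>) < 1\<close>.\<close>

lemma summable_window_sums:
  fixes m :: "nat \<Rightarrow> real" and \<delta> :: real
  assumes m: "\<And>u. 0 \<le> m u" and G: "\<And>t. t \<in> G \<Longrightarrow> (\<Sum>u=t div 2..<t. m u) \<le> 4 * ln t" and \<delta>: "0 < \<delta>"
  shows "summable (\<lambda>t. of_bool (t \<in> G) * (real t powr (- 1 / 2 - \<delta>) * (\<Sum>u=t div 2..<t. m u / sqrt (real (t - u)))))"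
    (is "summable (\<lambda>t. of_bool (t \<in> G) * (_ * ?W t))")
proof (rule summable_dyadic)
  have W: "0 \<le> ?W t" for t using m by (intro sum_nonneg) auto
  then show "0 \<le> of_bool (t \<in> G) * (real t powr (- 1 / 2 - \<delta>) * ?W t)" for t by simp
  define q where "q = (2 :: real) powr (- \<delta>)"
  have "q < 2 powr 0" unfolding q_def using \<delta> by (intro powr_less_mono) auto
  then have q: "0 < q" "q < 1" by (auto simp: q_def)
  show "summable (\<lambda>j. 32 * (real (Suc j) * q ^ j))"
    using geometric_deriv_sums[of q] q by (intro summable_mult) (auto simp: sums_iff)
  fix j
  define T where "T = (2 :: real) ^ j"
  have T: "0 < T" by (simp add: T_def)
  have "(\<Sum>t=2^j..<2^Suc j. of_bool (t \<in> G) * (real t powr (- 1 / 2 - \<delta>) * ?W t))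
      \<le> (\<Sum>t=2^j..<2^Suc j. of_bool (t \<in> G) * (T powr (- 1 / 2 - \<delta>) * ?W t))"
  proof (intro sum_mono mult_left_mono mult_right_mono W)
    fix t :: nat assume "t \<in> {2^j..<2^Suc j}"
    then have "real (2 ^ j) \<le> real t" by (simp only: of_nat_le_iff atLeastLessThan_iff)
    then have "T \<le> real t" by (simp add: T_def)
    then show "real t powr (- 1 / 2 - \<delta>) \<le> T powr (- 1 / 2 - \<delta>)"
      using T \<delta> by (intro powr_mono2') auto
  qed simp
  also have "\<dots> = T powr (- 1 / 2 - \<delta>) * (\<Sum>t\<in>{2^j..<2^Suc j} \<inter> G. ?W t)"
    by (simp add: sum_distrib_left sum.inter_restrict of_bool_def if_distrib if_distribR mult_ac cong: if_cong)
  also have "\<dots> \<le> T powr (- 1 / 2 - \<delta>) * (32 * real (Suc j) * sqrt T)"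
    unfolding T_def by (intro mult_left_mono block_sum_le m G) auto
  also have "\<dots> = 32 * (real (Suc j) * (T powr (- 1 / 2 - \<delta>) * T powr (1 / 2)))"
    using T by (simp add: powr_half_sqrt)
  also have "T powr (- 1 / 2 - \<delta>) * T powr (1 / 2) = q ^ j"
  proof -
    have "T = 2 powr j" by (simp add: T_def powr_realpow)
    then have "T powr (- \<delta>) = q ^ j" by (simp add: q_def powr_powr powr_power)
    then show ?thesis by (simp flip: powr_add)
  qed
  finally show "(\<Sum>t=2^j..<2^Suc j. of_bool (t \<in> G) * (real t powr (- 1 / 2 - \<delta>) * ?W t)) \<le> 32 * (real (Suc j) * q ^ j)" .
qed

text \<open>The argument reduced to numbers: \<open>p\<close> stands for the return probabilities,
  \<open>m\<close> for the squared Cheeger constants, \<open>a s\<close> and \<open>b t s\<close>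
  for the squared norms of the forward density and of the backward function ending at time
  \<open>t\<close>. Below the floor \<open>K / v s\<close> no contraction is claimed.\<close>

theorem summable_return_probabilities:
  fixes p m v :: "nat \<Rightarrow> real" and a :: "nat \<Rightarrow> real" and b :: "nat \<Rightarrow> nat \<Rightarrow> real" and \<gamma> D K :: real
  assumes \<gamma>: "0 < \<gamma>" "\<gamma> \<le> 1 / 2" and K: "0 < K" and D: "0 \<le> D"
    and m: "\<And>u. 0 \<le> m u"
    and v: "\<And>t. 1 \<le> v t" "\<And>s t. s \<le> t \<Longrightarrow> v s \<le> v t" "summable (\<lambda>t. 1 / v t)"
    and expsum: "summable (\<lambda>t. exp (- (\<Sum>u=t div 2..<t. m u)))"
    and p: "\<And>t. 0 \<le> p t" "\<And>s t. s \<le> t \<Longrightarrow> p t \<le> D * sqrt (a s * b t s)"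
    and a: "\<And>s. 0 \<le> a s" "a 0 \<le> 1" "\<And>s. a (Suc s) \<le> a s"
    and a_step: "\<And>s. a s \<le> K / v s \<or> a (Suc s) \<le> a s * exp (- (1 + \<gamma>) * m s)
        \<and> (a (Suc s))\<^sup>2 * (1 + (a s)\<^sup>2 / 16) \<le> (a s)\<^sup>2"
    and b: "\<And>t s. 0 \<le> b t s" "\<And>t. b t t \<le> 1" "\<And>t s. s < t \<Longrightarrow> b t s \<le> b t (Suc s)"
    and b_step: "\<And>t s. s < t \<Longrightarrow> b t s \<le> K / v s \<or> b t s \<le> b t (Suc s) * exp (- (1 + \<gamma>) * m s)
        \<and> (b t s)\<^sup>2 * (1 + (b t (Suc s))\<^sup>2 / 16) \<le> (b t (Suc s))\<^sup>2"
  shows "summable p"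
proof -
  obtain C where C: "0 < C" "\<And>t. 1 / v t \<le> C / real (Suc t)"
    using volume_linear_growth[of v] v by metis
  have vpos: "0 < v t" for t using v(1)[of t] by linarith
  have floor: "K / v t \<le> K * C / real (Suc t)" for t
    using mult_left_mono[OF C(2)[of t], of K] K by simp
  \<comment> \<open>The backward iteration counts steps \<open>j\<close> from \<open>t\<close>,
    while the floor belongs to time \<open>s\<close>. In the second half of the time interval
    \<open>Suc j \<le> 2 * Suc s\<close>, whence the factor 2.\<close>
  define K' where "K' = 2 * K * C"
  define Q where "Q = 16 + 2 * K'\<^sup>2"
  have Q: "0 < Q" by (simp add: Q_def add_pos_nonneg)
  have aQ: "(a k)\<^sup>2 * real (Suc k) \<le> Q" for k
    unfolding Q_def
  proof (rule nash_iteration[where n = k])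
    fix j
    consider "a j \<le> K / v j" | "(a (Suc j))\<^sup>2 * (1 + (a j)\<^sup>2 / 16) \<le> (a j)\<^sup>2" using a_step by blast
    then show "a (Suc j) \<le> K' / real (Suc j) \<or> (a (Suc j))\<^sup>2 * (1 + (a j)\<^sup>2 / 16) \<le> (a j)\<^sup>2"
    proof cases
      case 1
      have "a (Suc j) \<le> K * C / real (Suc j)" using a(3)[of j] 1 floor[of j] by linarith
      also have "\<dots> \<le> K' / real (Suc j)" using K C unfolding K'_def by (intro divide_right_mono) auto
      finally show ?thesis by simp
    qed simp
  qed (use a in auto)
  have bQ: "(b t (t - k))\<^sup>2 * real (Suc k) \<le> Q" if k: "k \<le> t - t div 2" for t k
    unfolding Q_def
  proof (rule nash_iteration[where n = k and z = "\<lambda>k. b t (t - k)"])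
    fix j assume j: "j < k"
    define s where "s = t - Suc j"
    have s: "s < t" "Suc s = t - j" "Suc j \<le> 2 * Suc s" using j k by (auto simp: s_def)
    consider "b t s \<le> K / v s" | "(b t s)\<^sup>2 * (1 + (b t (Suc s))\<^sup>2 / 16) \<le> (b t (Suc s))\<^sup>2"
      using b_step[OF s(1)] by blast
    then show "b t (t - Suc j) \<le> K' / real (Suc j)
        \<or> (b t (t - Suc j))\<^sup>2 * (1 + (b t (t - j))\<^sup>2 / 16) \<le> (b t (t - j))\<^sup>2"
    proof cases
      case 1
      have "b t s \<le> K * C / real (Suc s)" using 1 floor[of s] by linarith
      also have "\<dots> = K' / (2 * real (Suc s))" by (simp add: K'_def mult.assoc del: of_nat_Suc)
      also have "\<dots> \<le> K' / real (Suc j)"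
      proof (rule divide_left_mono)
        show "real (Suc j) \<le> 2 * real (Suc s)" using s(3) by linarith
      qed (use K C in \<open>auto simp: K'_def\<close>)
      finally show ?thesis by (simp add: s_def)
    qed (use s in \<open>simp add: s_def\<close>)
  qed (use b in auto)

  define F where "F t = (\<Sum>u=t div 2..<t. m u)" for t
  \<comment> \<open>\<theta> is half the rate \<open>1 + \<gamma>\<close>, \<eta> the multiple of
    \<open>ln t\<close> allowed to the window, \<delta> the surplus left in the power of
    \<open>t\<close>.\<close>
  define \<theta> \<eta> \<delta> where "\<theta> = (1 + \<gamma>) / 2" and "\<eta> = \<gamma> / 8" and "\<delta> = \<gamma> / 4"
  have pars: "1 / 2 \<le> \<theta>" "0 < \<theta>" "\<theta> < 1" "0 < \<eta>" "0 < \<delta>" using \<gamma> by (auto simp: \<theta>_def \<eta>_def \<delta>_def)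
  define A where "A = D * sqrt (2 * Q)"
  \<comment> \<open>\<open>meeting_time\<close> runs from \<open>t div 2\<close> to
    \<open>t - L\<close>, with the floor of the left end, the largest one there. At these ends Nash
    decay gives \<open>a\<close> of order \<open>t powr (- 1 / 2)\<close> and \<open>b\<close> of
    order \<open>Suc L powr (- 1 / 2)\<close>; the square root in \<open>p\<close> halves all
    exponents.\<close>
  have bound: "p t \<le> D * K * (1 / v (t div 2))
      + A * (real t powr (- 1 / 4) * real (Suc L) powr (- 1 / 4) * exp (- \<theta> * (\<Sum>u=t div 2..<t-L. m u)))"
    if t: "1 \<le> t" and L: "L \<le> t - t div 2" for t L
  proof -
    define s0 s1 where "s0 = t div 2" and "s1 = t - L"
    have s01: "s0 \<le> s1" "s1 \<le> t" using L by (auto simp: s0_def s1_def)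
    define \<kappa> where "\<kappa> = K / v s0"
    have fl: "K / v s \<le> \<kappa>" if "s0 \<le> s" for s
      unfolding \<kappa>_def using v(2)[OF that] vpos K by (intro divide_left_mono) (auto intro: less_imp_le)
    have \<kappa>: "0 \<le> \<kappa>" using K vpos[of s0] by (simp add: \<kappa>_def)
    define M where "M = (\<Sum>u=s0..<s1. m u)"
    have "\<exists>s. s0 \<le> s \<and> s \<le> s1 \<and> (a s * b t s \<le> \<kappa>\<^sup>2 \<or> a s * b t s \<le> a s0 * b t s1 * exp (- (1 + \<gamma>) * M))"
      unfolding M_def
    proof (rule meeting_time)
      show "a s \<le> \<kappa> \<or> a (Suc s) \<le> a s * exp (- (1 + \<gamma>) * m s)" if "s0 \<le> s" "s < s1" for s
        using a_step[of s] fl[OF that(1)] by auto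
      show "b t s \<le> \<kappa> \<or> b t s \<le> b t (Suc s) * exp (- (1 + \<gamma>) * m s)" if "s0 \<le> s" "s < s1" for s
        using b_step[of s t] fl[OF that(1)] that s01 by auto
    qed (use a b s01 in auto)
    then obtain s where s: "s \<le> t" "a s * b t s \<le> \<kappa>\<^sup>2 \<or> a s * b t s \<le> a s0 * b t s1 * exp (- (1 + \<gamma>) * M)"
      using s01 by (meson order_trans)
    have half: "exp (- (1 + \<gamma>) * M) = (exp (- \<theta> * M))\<^sup>2"
      by (simp add: \<theta>_def power2_eq_square flip: exp_add) (simp add: field_simps)
    have "sqrt (a s * b t s) \<le> \<kappa> + sqrt (a s0 * b t s1) * exp (- \<theta> * M)"
    proof -
      consider "a s * b t s \<le> \<kappa>\<^sup>2" | "a s * b t s \<le> a s0 * b t s1 * (exp (- \<theta> * M))\<^sup>2" using s(2) half by metis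
      then show ?thesis
      proof cases
        case 1
        then have "sqrt (a s * b t s) \<le> \<kappa>" using \<kappa> by (auto intro: real_le_lsqrt)
        then show ?thesis using a(1) b(1) by (simp add: add_increasing2)
      next
        case 2
        then have "sqrt (a s * b t s) \<le> sqrt (a s0 * b t s1 * (exp (- \<theta> * M))\<^sup>2)" by (rule real_sqrt_le_mono)
        also have "\<dots> = sqrt (a s0 * b t s1) * exp (- \<theta> * M)" by (simp add: real_sqrt_mult)
        finally show ?thesis using \<kappa> by simp
      qed
    qed
    moreover have "sqrt (a s0 * b t s1) \<le> sqrt (2 * Q) * (real t powr (- 1 / 4) * real (Suc L) powr (- 1 / 4))"
    proof -
      define X where "X = real t powr (- 1 / 4) * real (Suc L) powr (- 1 / 4)"
      have X: "X ^ 4 = 1 / (real t * real (Suc L))"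
      proof -
        have "(x powr (- 1 / 4)) ^ 4 = 1 / x" if "0 < x" for x :: real
          using that powr_power[of x "- 1 / 4" 4] powr_minus_divide[of x 1] by simp
        then show ?thesis using t by (simp add: X_def power_mult_distrib del: of_nat_Suc)
      qed
      have "(a s0)\<^sup>2 * (real t / 2) \<le> (a s0)\<^sup>2 * real (Suc s0)" unfolding s0_def by (intro mult_left_mono) auto
      then have 1: "(a s0)\<^sup>2 * real t \<le> 2 * Q" using aQ[of s0] by simp
      have 2: "(b t s1)\<^sup>2 * real (Suc L) \<le> 2 * Q" using bQ[OF L] Q by (simp add: s1_def)
      have "((a s0)\<^sup>2 * real t) * ((b t s1)\<^sup>2 * real (Suc L)) \<le> (2 * Q) * (2 * Q)"
        using Q by (intro mult_mono 1 2) auto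
      then have "(a s0 * b t s1)\<^sup>2 * (real t * real (Suc L)) \<le> (2 * Q)\<^sup>2"
        by (simp add: power2_eq_square mult_ac del: of_nat_Suc)
      then have "(a s0 * b t s1)\<^sup>2 \<le> (2 * Q)\<^sup>2 * X ^ 4"
        using t unfolding X by (simp add: pos_le_divide_eq del: of_nat_Suc)
      also have "\<dots> = (2 * Q * X\<^sup>2)\<^sup>2" by (simp add: power_mult_distrib flip: power_mult)
      finally have "a s0 * b t s1 \<le> 2 * Q * X\<^sup>2"
        by (rule power2_le_imp_le) (use Q in simp)
      then have "sqrt (a s0 * b t s1) \<le> sqrt (2 * Q * X\<^sup>2)" by (rule real_sqrt_le_mono)
      also have "\<dots> = sqrt (2 * Q) * X" by (simp add: real_sqrt_mult X_def)
      finally show ?thesis by (simp add: X_def)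
    qed
    ultimately have "sqrt (a s * b t s) \<le> \<kappa>
        + sqrt (2 * Q) * (real t powr (- 1 / 4) * real (Suc L) powr (- 1 / 4)) * exp (- \<theta> * M)"
      by (smt (verit) exp_ge_zero mult_right_mono)
    from order_trans[OF p(2)[OF s(1)] mult_left_mono[OF this D]]
    show ?thesis by (simp add: \<kappa>_def M_def s0_def s1_def A_def algebra_simps)
  qed
  have A: "0 \<le> A" using D Q by (simp add: A_def)

  \<comment> \<open>Off \<open>G\<close> the choice \<open>L = 0\<close> suffices:
    \<open>\<theta> \<ge> 1 / 2\<close> turns \<open>F t > 4 * ln t\<close> into the summable
    \<open>t powr (- 2)\<close>. On \<open>G\<close> the exponents are logarithmic, as the block
    estimate requires.\<close>
  define G where "G = {t. F t \<le> 4 * ln t}"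
  define R where "R t = of_bool (t \<in> G) * (real t powr (- 1 / 2 - \<delta>) * (\<Sum>u=t div 2..<t. m u / sqrt (real (t - u))))" for t
  have R: "0 \<le> R t" for t unfolding R_def using m by (intro mult_nonneg_nonneg sum_nonneg) auto
  define c where "c = 1 / (\<eta> * ln 2)"
  have c: "0 < c" using pars by (simp add: c_def)
  have main: "p t \<le> D * K * (1 / v (t div 2))
      + A * (exp (- F t) + real t powr (- 2) + sqrt 2 * real t powr (- 1 - \<delta>) + c * R t)"
    if t: "2 \<le> t" for t
  proof (cases "t \<in> G")
    case False
    have "exp (- \<theta> * F t) \<le> exp (- 2 * ln t)"
    proof -
      have "(1 / 2) * (4 * ln t) \<le> \<theta> * F t"
        using False pars t by (intro mult_mono) (auto simp: G_def)
      then show ?thesis by simp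
    qed
    also have "\<dots> = real t powr (- 2)" using t by (simp add: powr_def)
    finally have "exp (- \<theta> * F t) \<le> real t powr (- 2)" .
    moreover have "real t powr (- 1 / 4) \<le> 1" using powr_mono[of "- 1 / 4" 0 "real t"] t by simp
    ultimately have "real t powr (- 1 / 4) * 1 * exp (- \<theta> * F t) \<le> 1 * 1 * real t powr (- 2)"
      by (intro mult_mono) auto
    moreover have "0 \<le> exp (- F t) + sqrt 2 * real t powr (- 1 - \<delta>) + c * R t"
      using R[of t] c by simp
    ultimately have "real t powr (- 1 / 4) * 1 * exp (- \<theta> * F t)
        \<le> exp (- F t) + real t powr (- 2) + sqrt 2 * real t powr (- 1 - \<delta>) + c * R t"
      by linarith
    from mult_left_mono[OF this A] show ?thesis
      using bound[of t 0] t unfolding F_def by (simp only: minus_nat.diff_0 of_nat_1 One_nat_def[symmetric] powr_one_eq_one) linarith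
  next
    case True
    obtain L where L: "L \<le> t - t div 2" "(\<Sum>u=t-L..<t. m u) \<le> \<eta> * ln t"
      "1 / sqrt (real (Suc L)) \<le> sqrt 2 / sqrt t + (\<Sum>u=t div 2..<t. m u / sqrt (real (t - u))) / (\<eta> * ln t)"
      by (rule choose_window[of m, OF m \<open>0 < \<eta>\<close> t])
    \<comment> \<open>Leaving the window out of the exponent costs at most
      \<open>t powr (\<theta> * \<eta>)\<close>. Young's inequality then separates the summable
      \<open>exp (- F t)\<close> from a power of \<open>x\<close>.\<close>
    define x where "x = real t powr (- 1 / 4 + \<theta> * \<eta>) * real (Suc L) powr (- 1 / 4)"
    have "F t = (\<Sum>u=t div 2..<t-L. m u) + (\<Sum>u=t-L..<t. m u)"
      unfolding F_def by (rule sum.atLeastLessThan_concat[symmetric]) (use L in auto)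
    then have "\<theta> * (F t - \<eta> * ln t) \<le> \<theta> * (\<Sum>u=t div 2..<t-L. m u)"
      using L(2) pars by (intro mult_left_mono) auto
    then have "exp (- \<theta> * (\<Sum>u=t div 2..<t-L. m u)) \<le> exp (\<theta> * \<eta> * ln t + (- \<theta> * F t))"
      by (simp add: algebra_simps)
    also have "\<dots> = real t powr (\<theta> * \<eta>) * exp (- F t) powr \<theta>"
      using t unfolding exp_add by (simp add: powr_def)
    finally have "real t powr (- 1 / 4) * real (Suc L) powr (- 1 / 4) * exp (- \<theta> * (\<Sum>u=t div 2..<t-L. m u))
        \<le> real t powr (- 1 / 4) * real (Suc L) powr (- 1 / 4) * (real t powr (\<theta> * \<eta>) * exp (- F t) powr \<theta>)"
      by (intro mult_left_mono) auto
    also have "\<dots> = x * exp (- F t) powr \<theta>"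
      unfolding x_def powr_add by (simp only: mult_ac)
    also have "\<dots> \<le> exp (- F t) + x powr (1 / (1 - \<theta>))"
      using pars by (intro mult_powr_le) (auto simp: x_def)
    also have "x powr (1 / (1 - \<theta>)) \<le> sqrt 2 * real t powr (- 1 - \<delta>) + c * R t"
    proof -
      define e where "e = 1 / (1 - \<theta>)"
      have e: "e = 2 / (1 - \<gamma>)" by (simp add: e_def \<theta>_def field_simps)
      have e2: "2 \<le> e" using \<gamma> by (simp add: e field_simps)
      \<comment> \<open>The conjugate exponent \<open>e = 2 / (1 - \<gamma>)\<close> exceeds 2 by
        enough to absorb the loss \<open>\<theta> * \<eta>\<close> and still leave \<delta>; for
        \<open>Suc L\<close> the bound \<open>2 \<le> e\<close> is enough.\<close>
      have "(- 1 / 4 + \<theta> * \<eta>) * 2 \<le> (- 1 / 2 - \<delta>) * (1 - \<gamma>)"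
        using \<gamma> by (simp add: \<theta>_def \<eta>_def \<delta>_def field_simps power2_eq_square)
      then have expo: "(- 1 / 4 + \<theta> * \<eta>) * e \<le> - 1 / 2 - \<delta>"
        using \<gamma> by (simp add: e pos_divide_le_eq)
      have "x powr e = real t powr ((- 1 / 4 + \<theta> * \<eta>) * e) * real (Suc L) powr ((- 1 / 4) * e)"
        unfolding x_def by (simp add: powr_mult powr_powr del: of_nat_Suc)
      also have "\<dots> \<le> real t powr (- 1 / 2 - \<delta>) * real (Suc L) powr (- 1 / 2)"
        using t e2 expo by (intro mult_mono powr_mono) auto
      also have "real (Suc L) powr (- 1 / 2) = 1 / sqrt (real (Suc L))"
        using powr_minus_divide[of "real (Suc L)" "1/2"] by (simp add: powr_half_sqrt del: of_nat_Suc)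
      also have "real t powr (- 1 / 2 - \<delta>) * \<dots> \<le> real t powr (- 1 / 2 - \<delta>) *
          (sqrt 2 / sqrt t + (\<Sum>u=t div 2..<t. m u / sqrt (real (t - u))) * c)"
      proof (intro mult_left_mono order_trans[OF L(3)] add_left_mono)
        have "ln 2 \<le> ln t" using t by simp
        then have "1 / (\<eta> * ln t) \<le> c"
          unfolding c_def using pars t by (intro divide_left_mono mult_left_mono) auto
        then have "(\<Sum>u=t div 2..<t. m u / sqrt (real (t - u))) * (1 / (\<eta> * ln t))
            \<le> (\<Sum>u=t div 2..<t. m u / sqrt (real (t - u))) * c"
          using m by (intro mult_left_mono sum_nonneg) auto
        then show "(\<Sum>u=t div 2..<t. m u / sqrt (real (t - u))) / (\<eta> * ln t)
            \<le> (\<Sum>u=t div 2..<t. m u / sqrt (real (t - u))) * c" by simp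
      qed simp
      also have "\<dots> = sqrt 2 * (real t powr (- 1 / 2 - \<delta>) / sqrt t) + c * R t"
        using True by (simp add: R_def algebra_simps)
      also have "real t powr (- 1 / 2 - \<delta>) / sqrt t = real t powr (- 1 - \<delta>)"
      proof -
        have "1 / sqrt t = real t powr (- 1 / 2)"
          using powr_minus_divide[of "real t" "1/2"] by (simp add: powr_half_sqrt)
        then have "real t powr (- 1 / 2 - \<delta>) / sqrt t = real t powr (- 1 / 2 - \<delta>) * real t powr (- 1 / 2)"
          by (metis mult.right_neutral times_divide_eq_right)
        then show ?thesis by (simp add: powr_add[symmetric])
      qed
      finally show ?thesis by (simp add: e_def)
    qed
    finally have "real t powr (- 1 / 4) * real (Suc L) powr (- 1 / 4) * exp (- \<theta> * (\<Sum>u=t div 2..<t-L. m u))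
        \<le> exp (- F t) + real t powr (- 2) + sqrt 2 * real t powr (- 1 - \<delta>) + c * R t"
      using powr_ge_zero[of "real t" "- 2"] by linarith
    from mult_left_mono[OF this A] show ?thesis using bound[OF _ L(1)] t by linarith
  qed
  have "summable (\<lambda>t. D * K * (1 / v (t div 2))
      + A * (exp (- F t) + real t powr (- 2) + sqrt 2 * real t powr (- 1 - \<delta>) + c * R t))"
  proof (intro summable_add summable_mult)
    show "summable (\<lambda>t. 1 / v (t div 2))"
      using v(3) vpos by (intro summable_div2[where f = "\<lambda>t. 1 / v t"]) (auto intro: less_imp_le)
    show "summable (\<lambda>t. exp (- F t))" using expsum by (simp add: F_def)
    show "summable (\<lambda>t. real t powr (- 2))" "summable (\<lambda>t. real t powr (- 1 - \<delta>))"
      using pars by (simp_all add: summable_real_powr_iff)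
    show "summable R"
      unfolding R_def using m pars by (intro summable_window_sums) (auto simp: G_def F_def)
  qed
  then show ?thesis
    by (rule summable_comparison_test') (use main p(1) in auto)
qed

section \<open>Networks of a growing sequence of graphs\<close>

lemma mult_sym: "mult ends F x y = mult ends F y x"
  by (simp add: mult_def insert_commute)

lemma (in growing_graphs) nonisolated_subset: "nonisolated ends (Et t) \<subseteq> V"
proof
  fix x assume "x \<in> nonisolated ends (Et t)"
  then obtain y e where "e \<in> Et t" "ends e = {x, y}"
    by (auto simp: nonisolated_def adj_def)
  then show "x \<in> V" using ends_in_V[of e] Et_subset[of t] by (auto simp: doubleton_eq_iff)
qed

lemma (in growing_graphs) Et_mono': "s \<le> t \<Longrightarrow> Et s \<subseteq> Et t"
  using Et_mono by (rule lift_Suc_mono_le)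

lemma (in growing_graphs) nonisolated_mono: "s \<le> t \<Longrightarrow> nonisolated ends (Et s) \<subseteq> nonisolated ends (Et t)"
  using Et_mono'[of s t] by (fastforce simp: nonisolated_def adj_def)

lemma (in growing_graphs) finite_edges: "x \<in> V \<Longrightarrow> finite {e \<in> Et t. ends e = {x, y}}"
  using Et_subset[of t] by (intro finite_subset[OF _ locally_finite[of x]]) auto

lemma (in growing_graphs) mult_increasing: "s \<le> t \<Longrightarrow> x \<in> V \<Longrightarrow> mult ends (Et s) x y \<le> mult ends (Et t) x y"
  using Et_mono'[of s t] unfolding mult_def by (intro card_mono finite_edges) auto

lemma (in growing_graphs) mult_ge_1: "x \<in> V \<Longrightarrow> (x, y) \<in> adj ends (Et t) \<Longrightarrow> 1 \<le> mult ends (Et t) x y"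
  using finite_edges[of x t y] by (auto simp: mult_def adj_def Suc_le_eq card_gt_0_iff)

lemma adj_nonisolated: "(x, y) \<in> adj ends F \<Longrightarrow> x \<noteq> y \<Longrightarrow> y \<in> nonisolated ends F"
  by (force simp: nonisolated_def adj_def insert_commute)

lemma (in growing_graphs) deg_pos:
  assumes x: "x \<in> nonisolated ends (Et t)"
  shows "1 \<le> deg ends (Et t) x"
proof -
  obtain y where y: "y \<noteq> x" "(x, y) \<in> adj ends (Et t)" using x by (auto simp: nonisolated_def)
  have "1 \<le> mult ends (Et t) x y" using mult_ge_1[OF _ y(2)] x nonisolated_subset by auto
  also have "\<dots> \<le> deg ends (Et t) x"
    unfolding deg_def using y adj_nonisolated[OF y(2)] finite_Vt by (intro member_le_sum) auto
  finally show ?thesis .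
qed

lemma (in growing_graphs) deg_mono:
  assumes "s \<le> t" "x \<in> V"
  shows "deg ends (Et s) x \<le> deg ends (Et t) x"
proof -
  have "deg ends (Et s) x \<le> (\<Sum>y\<in>nonisolated ends (Et s). mult ends (Et t) x y)"
    unfolding deg_def using assms by (intro sum_mono mult_increasing)
  also have "\<dots> \<le> deg ends (Et t) x"
    unfolding deg_def using assms finite_Vt by (intro sum_mono2 nonisolated_mono) auto
  finally show ?thesis .
qed

lemma (in growing_graphs) vol_mono: "s \<le> t \<Longrightarrow> vol ends (Et s) \<le> vol ends (Et t)"
proof -
  assume st: "s \<le> t"
  have "vol ends (Et s) \<le> (\<Sum>x\<in>nonisolated ends (Et s). deg ends (Et t) x)"
    unfolding vol_def deg_set_def using st nonisolated_subset by (intro sum_mono deg_mono) auto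
  also have "\<dots> \<le> vol ends (Et t)"
    unfolding vol_def deg_set_def using st finite_Vt by (intro sum_mono2 nonisolated_mono) auto
  finally show ?thesis .
qed

text \<open>A path from \<open>A\<close> to its complement, which connectedness provides, has to
  leave \<open>A\<close> along some edge.\<close>

lemma (in growing_graphs) boundary_ge_1:
  assumes A: "A \<noteq> {}" "A \<subseteq> nonisolated ends (Et t)" "A \<noteq> nonisolated ends (Et t)"
  shows "1 \<le> mult_sets ends (Et t) A (nonisolated ends (Et t) - A)"
proof -
  obtain x y where xy: "x \<in> A" "y \<in> nonisolated ends (Et t) - A" using A by auto
  then have "(x, y) \<in> (adj ends (Et t))\<^sup>*" using connected_Gt[of t] A by (auto simp: connected_graph_def)
  then have "y \<in> A \<or> (\<exists>u v. u \<in> A \<and> v \<notin> A \<and> (u, v) \<in> adj ends (Et t))"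
    by (induction rule: rtrancl_induct) (use xy in auto)
  then obtain u v where uv: "u \<in> A" "v \<notin> A" "(u, v) \<in> adj ends (Et t)" using xy by auto
  then have v: "v \<in> nonisolated ends (Et t) - A" using adj_nonisolated[OF uv(3)] by auto
  have fin: "finite A" "finite (nonisolated ends (Et t) - A)" using A finite_Vt finite_subset by auto
  have "1 \<le> mult ends (Et t) u v" using mult_ge_1[OF _ uv(3)] uv A nonisolated_subset by auto
  also have "\<dots> \<le> (\<Sum>y\<in>nonisolated ends (Et t) - A. mult ends (Et t) u y)"
    using v fin by (intro member_le_sum) auto
  also have "\<dots> \<le> mult_sets ends (Et t) A (nonisolated ends (Et t) - A)"
    unfolding mult_sets_def using uv fin by (intro member_le_sum) auto
  finally show ?thesis .
qed

lemma (in growing_graphs) cheeger_le: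
  assumes A: "A \<noteq> {}" "A \<subseteq> nonisolated ends (Et t)"
    "real (deg_set ends (Et t) A) \<le> real (vol ends (Et t)) / 2"
  shows "cheeger ends (Et t) * real (deg_set ends (Et t) A)
    \<le> real (mult_sets ends (Et t) A (nonisolated ends (Et t) - A))"
proof -
  obtain x where x: "x \<in> A" using A by auto
  have "finite A" using A finite_Vt finite_subset by auto
  then have "deg ends (Et t) x \<le> deg_set ends (Et t) A"
    unfolding deg_set_def using x by (intro member_le_sum) auto
  \<comment> \<open>Positivity rules out the convention for division by zero, so the quotient can be
    cleared.\<close>
  then have pos: "0 < real (deg_set ends (Et t) A)" using deg_pos[of x t] x A by auto
  have "cheeger ends (Et t)
      \<le> real (mult_sets ends (Et t) A (nonisolated ends (Et t) - A)) / real (deg_set ends (Et t) A)"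
    unfolding cheeger_def
  proof (rule cInf_lower)
    show "bdd_below {real (mult_sets ends (Et t) A (nonisolated ends (Et t) - A)) / real (deg_set ends (Et t) A) | A.
            A \<noteq> {} \<and> A \<subseteq> nonisolated ends (Et t) \<and>
            real (deg_set ends (Et t) A) \<le> real (vol ends (Et t)) / 2}"
      by (rule bdd_belowI[of _ 0]) auto
  qed (use A in blast)
  then show ?thesis using pos by (simp add: pos_le_divide_eq)
qed

text \<open>The infimum defining the Cheeger constant ranges over a nonempty set: a graph with an edge
  between distinct vertices has a vertex carrying at most half of the volume.\<close>

lemma (in growing_graphs) cheeger_nonneg:
  assumes "nonisolated ends (Et t) \<noteq> {}"
  shows "0 \<le> cheeger ends (Et t)"
proof -
  obtain x where x: "x \<in> nonisolated ends (Et t)" using assms by auto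
  then obtain y where y: "y \<noteq> x" "(x, y) \<in> adj ends (Et t)" by (auto simp: nonisolated_def)
  have yV: "y \<in> nonisolated ends (Et t)" using adj_nonisolated[OF y(2)] y by auto
  have "deg ends (Et t) x + deg ends (Et t) y = (\<Sum>z\<in>{x, y}. deg ends (Et t) z)" using y by simp
  also have "\<dots> \<le> vol ends (Et t)"
    unfolding vol_def deg_set_def using x yV finite_Vt by (intro sum_mono2) auto
  finally have "2 * deg ends (Et t) x \<le> vol ends (Et t) \<or> 2 * deg ends (Et t) y \<le> vol ends (Et t)" by linarith
  then obtain z where z: "z \<in> nonisolated ends (Et t)" "2 * deg ends (Et t) z \<le> vol ends (Et t)"
    using x yV by auto
  have "real (deg_set ends (Et t) {z}) \<le> real (vol ends (Et t)) / 2"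
    using z(2) by (simp add: deg_set_def)
  then show ?thesis
    unfolding cheeger_def by (intro cInf_greatest) (use z in auto)
qed

locale lazy_growing_graphs = growing_graphs V E ends Et
  for V :: "'a set" and E :: "'e set" and ends :: "'e \<Rightarrow> 'a set" and Et :: "nat \<Rightarrow> 'e set" +
  fixes x0 :: 'a and \<gamma> :: real
  assumes start: "x0 \<in> nonisolated ends (Et 0)"
    and laziness: "0 < \<gamma>" "\<gamma> \<le> 1 / 2"
      "\<And>t x. x \<in> nonisolated ends (Et t) \<Longrightarrow> \<gamma> \<le> srw_trans ends Et t x x"
begin

abbreviation "Vt t \<equiv> nonisolated ends (Et t)"
abbreviation "weight t x y \<equiv> real (mult ends (Et t) x y)"

lemma Suc_subset: "Vt t \<subseteq> Vt (Suc t)"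
  by (rule nonisolated_mono) simp

lemma x0_in: "x0 \<in> Vt t"
  using start nonisolated_mono[of 0 t] by auto

lemma sum_weight: "(\<Sum>y\<in>Vt t. weight t x y) = real (deg ends (Et t) x)"
  by (simp add: deg_def)

sublocale net: lazy_network "Vt t" "weight t" \<gamma> for t
proof
  fix x assume x: "x \<in> Vt t"
  then show "0 < (\<Sum>y\<in>Vt t. weight t x y)" using deg_pos[OF x] unfolding sum_weight by simp
  then show "\<gamma> * (\<Sum>y\<in>Vt t. weight t x y) \<le> weight t x x"
    using laziness(3)[OF x] unfolding sum_weight srw_trans_def by (simp add: pos_le_divide_eq)
qed (use finite_Vt laziness in \<open>auto simp: mult_sym\<close>)

lemma d_eq: "net.d t x = real (deg ends (Et t) x)"
  by (simp add: net.d_def sum_weight)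

lemma v_eq: "net.v t = real (vol ends (Et t))"
  by (simp add: net.v_def d_eq vol_def deg_set_def)

lemma d_ge_1: "x \<in> Vt t \<Longrightarrow> 1 \<le> net.d t x"
  using deg_pos by (simp add: d_eq)

lemma d_mono: "x \<in> Vt t \<Longrightarrow> net.d t x \<le> net.d (Suc t) x"
  using deg_mono[of t "Suc t" x] nonisolated_subset[of t] by (auto simp: d_eq)

lemma v_ge_1: "1 \<le> net.v t"
proof -
  have "1 \<le> net.d t x0" using d_ge_1 x0_in by auto
  also have "\<dots> \<le> net.v t" unfolding net.v_def using x0_in finite_Vt by (intro member_le_sum) (auto simp: d_eq)
  finally show ?thesis .
qed

lemma v_mono: "s \<le> t \<Longrightarrow> net.v s \<le> net.v t"
  by (simp add: v_eq vol_mono)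

lemma energy_step:
  assumes h: "\<And>x. x \<in> Vt t \<Longrightarrow> 0 \<le> h x" "(\<Sum>x\<in>Vt t. net.d t x * h x) \<le> 1"
    and large: "8 / \<gamma> ^ 4 / net.v t \<le> net.energy t h"
  shows "net.energy t (net.P t h) \<le> net.energy t h * exp (- (1 + \<gamma>) * (cheeger ends (Et t))\<^sup>2)"
    and "(net.energy t (net.P t h))\<^sup>2 * (1 + (net.energy t h)\<^sup>2 / 16) \<le> (net.energy t h)\<^sup>2"
proof -
  have "0 \<le> cheeger ends (Et t)" using x0_in by (intro cheeger_nonneg) auto
  moreover have sums: "sum (net.d t) A = real (deg_set ends (Et t) A)"
    "(\<Sum>x\<in>A. \<Sum>y\<in>Vt t - A. weight t x y) = real (mult_sets ends (Et t) A (Vt t - A))" for A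
    by (auto simp: d_eq deg_set_def mult_sets_def)
  moreover have "cheeger ends (Et t) * sum (net.d t) A \<le> (\<Sum>x\<in>A. \<Sum>y\<in>Vt t - A. weight t x y)"
    if "A \<noteq> {}" "A \<subseteq> Vt t" "sum (net.d t) A \<le> net.v t / 2" for A
    using cheeger_le[OF that(1,2)] that(3) unfolding sums v_eq by simp
  moreover have "1 \<le> (\<Sum>x\<in>A. \<Sum>y\<in>Vt t - A. weight t x y)"
    if "A \<noteq> {}" "A \<subseteq> Vt t" "sum (net.d t) A \<le> net.v t / 2" for A
  proof -
    \<comment> \<open>The full vertex set has volume \<open>v > v / 2\<close>.\<close>
    have "A \<noteq> Vt t" using that(3) v_ge_1[of t] by (auto simp: net.v_def)
    then show ?thesis using boundary_ge_1[OF that(1,2)] unfolding sums by simp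
  qed
  moreover have "0 < net.v t" using v_ge_1[of t] by simp
  ultimately show "net.energy t (net.P t h) \<le> net.energy t h * exp (- (1 + \<gamma>) * (cheeger ends (Et t))\<^sup>2)"
    and "(net.energy t (net.P t h))\<^sup>2 * (1 + (net.energy t h)\<^sup>2 / 16) \<le> (net.energy t h)\<^sup>2"
    using net.energy_step[of t h "cheeger ends (Et t)"] h large by blast+
qed

lemma srw_trans_eq: "srw_trans ends Et t x y = weight t x y / net.d t x"
  by (simp add: srw_trans_def d_eq)

lemma sum_srw_trans: "x \<in> Vt t \<Longrightarrow> (\<Sum>y\<in>Vt t. srw_trans ends Et t x y) = 1"
  using net.d_pos[of x t] by (simp add: srw_trans_eq sum_divide_distrib[symmetric] net.d_def)

lemma srw_trans_outside: "x \<in> Vt t \<Longrightarrow> y \<notin> Vt t \<Longrightarrow> srw_trans ends Et t x y = 0"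
proof -
  assume xy: "x \<in> Vt t" "y \<notin> Vt t"
  then have "(x, y) \<notin> adj ends (Et t)" using adj_nonisolated[of x y ends "Et t"] by auto
  then have "{e \<in> Et t. ends e = {x, y}} = {}" by (auto simp: adj_def)
  then have "mult ends (Et t) x y = 0" unfolding mult_def by (simp only: card.empty)
  then show ?thesis by (simp add: srw_trans_def)
qed

text \<open>The backward functions \<open>g\<^sub>s(x) = P(s, x; t, x\<^sub>0)\<close>, indexed by \<open>k = t - s\<close>.\<close>

primrec backward :: "nat \<Rightarrow> nat \<Rightarrow> 'a \<Rightarrow> real" where
  "backward t 0 = (\<lambda>x. of_bool (x = x0))"
| "backward t (Suc k) = net.P (t - Suc k) (backward t k)"

end

section \<open>Forward densities and backward functions\<close>

text \<open>Isolates what the analysis takes from the probability space: \<open>u t\<close> models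
  the law of the walk at time \<open>t\<close>, with all its mass on the vertices present at that
  time, and \<open>D\<close> bounds all degrees.\<close>

locale return_law = lazy_growing_graphs V E ends Et x0 \<gamma>
  for V :: "'a set" and E :: "'e set" and ends :: "'e \<Rightarrow> 'a set" and Et :: "nat \<Rightarrow> 'e set"
    and x0 :: 'a and \<gamma> :: real +
  fixes D :: real and u :: "nat \<Rightarrow> 'a \<Rightarrow> real"
  assumes D: "x \<in> nonisolated ends (Et t) \<Longrightarrow> real (deg ends (Et t) x) \<le> D"
    and u_nonneg: "0 \<le> u t x"
    and u_0: "x \<in> nonisolated ends (Et 0) \<Longrightarrow> u 0 x = of_bool (x = x0)"
    and u_Suc: "y \<in> nonisolated ends (Et (Suc t)) \<Longrightarrow>
      u (Suc t) y = (\<Sum>x\<in>nonisolated ends (Et t). u t x * srw_trans ends Et t x y)"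
    and u_mass: "(\<Sum>x\<in>nonisolated ends (Et t). u t x) = 1"
begin

lemma D_ge_1: "1 \<le> D"
  using order_trans[OF d_ge_1[OF x0_in] D[OF x0_in[of 0], folded d_eq]] .

definition h :: "nat \<Rightarrow> 'a \<Rightarrow> real" where "h t x = u t x / net.d t x"

text \<open>Division by \<open>D\<close> normalises the mass: at \<open>s = t\<close> it is the
  degree of \<open>x0\<close> over \<open>D\<close>, hence at most 1.\<close>

definition g :: "nat \<Rightarrow> nat \<Rightarrow> 'a \<Rightarrow> real" where "g t s x = backward t (t - s) x / D"

lemma h_nonneg: "x \<in> Vt t \<Longrightarrow> 0 \<le> h t x"
  using u_nonneg net.d_pos[of x t] by (simp add: h_def)

lemma h_mass: "(\<Sum>x\<in>Vt t. net.d t x * h t x) \<le> 1"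
  using u_mass[of t] net.d_pos[of _ t] by (simp add: h_def order_less_imp_not_eq2)

lemma u_outside: "y \<in> Vt (Suc t) - Vt t \<Longrightarrow> u (Suc t) y = 0"
  by (simp add: u_Suc srw_trans_outside)

text \<open>Detailed balance: by symmetry of the weights, moving the law forward amounts to
  averaging the density, still relative to the old degrees.\<close>

lemma P_h:
  assumes y: "y \<in> Vt t"
  shows "net.P t (h t) y = u (Suc t) y / net.d t y"
proof -
  have "y \<in> Vt (Suc t)" using y Suc_subset by auto
  then show ?thesis
    by (simp add: u_Suc net.P_def h_def srw_trans_eq mult_sym[of ends _ y] mult_ac)
qed

text \<open>Vertices appearing at time \<open>Suc t\<close> cannot be reached along edges of
  \<open>Et t\<close>, and on the old ones \<open>u^2 / d\<close> falls as the degree grows.\<close>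

lemma energy_h_Suc_le: "net.energy (Suc t) (h (Suc t)) \<le> net.energy t (net.P t (h t))"
proof -
  have sq: "z * (y / z)\<^sup>2 = y\<^sup>2 / z" if "1 \<le> z" for y z :: real
    using that by (simp add: power2_eq_square)
  have "net.energy (Suc t) (h (Suc t)) = (\<Sum>x\<in>Vt (Suc t). (u (Suc t) x)\<^sup>2 / net.d (Suc t) x)"
    unfolding net.energy_def h_def using sq d_ge_1 by (intro sum.cong) auto
  also have "\<dots> = (\<Sum>x\<in>Vt t. (u (Suc t) x)\<^sup>2 / net.d (Suc t) x)"
    using finite_Vt Suc_subset u_outside by (intro sum.mono_neutral_right) auto
  also have "\<dots> \<le> (\<Sum>x\<in>Vt t. (u (Suc t) x)\<^sup>2 / net.d t x)"
    using d_mono net.d_pos[of _ t] less_le_trans[OF net.d_pos[of _ t] d_mono]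
    by (intro sum_mono divide_left_mono mult_pos_pos) auto
  also have "\<dots> = net.energy t (net.P t (h t))"
    unfolding net.energy_def using sq d_ge_1 P_h by (intro sum.cong) auto
  finally show ?thesis .
qed

lemma energy_h_0: "net.energy 0 (h 0) \<le> 1"
proof -
  have "net.energy 0 (h 0) = (\<Sum>x\<in>Vt 0. if x = x0 then 1 / net.d 0 x0 else 0)"
    unfolding net.energy_def h_def using u_0 d_ge_1[of _ 0] by (intro sum.cong) (auto simp: power2_eq_square)
  also have "\<dots> \<le> 1" using finite_Vt start d_ge_1[of x0 0] by simp
  finally show ?thesis .
qed

lemma energy_mono: "net.energy t f \<le> net.energy (Suc t) f"
proof -
  have "net.energy t f \<le> (\<Sum>x\<in>Vt t. net.d (Suc t) x * (f x)\<^sup>2)"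
    unfolding net.energy_def using d_mono by (intro sum_mono mult_right_mono) auto
  also have "\<dots> \<le> net.energy (Suc t) f"
    unfolding net.energy_def using finite_Vt Suc_subset by (intro sum_mono2) (auto simp: d_eq)
  finally show ?thesis .
qed

lemma g_step: "s < t \<Longrightarrow> g t s = net.P s (g t (Suc s))"
proof -
  assume "s < t"
  then obtain k where "t - s = Suc k" "t - Suc s = k" "t - Suc k = s"
    by (metis Suc_diff_Suc diff_diff_cancel less_imp_le)
  then show ?thesis by (auto simp: g_def net.P_def fun_eq_iff sum_divide_distrib mult.commute)
qed

lemma g_self: "g t t x = of_bool (x = x0) / D"
  by (simp add: g_def)

lemma g_nonneg: "s \<le> t \<Longrightarrow> x \<in> Vt s \<Longrightarrow> 0 \<le> g t s x"
proof (induction arbitrary: x rule: inc_induct)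
  case base
  then show ?case using D_ge_1 by (simp add: g_self)
next
  case (step s)
  then show ?case unfolding g_step[OF step(2)] using Suc_subset by (intro net.P_nonneg) auto
qed

lemma g_mass_restrict:
  assumes "s < t"
  shows "(\<Sum>x\<in>Vt s. net.d s x * g t (Suc s) x) \<le> (\<Sum>x\<in>Vt (Suc s). net.d (Suc s) x * g t (Suc s) x)"
proof -
  have nn: "0 \<le> g t (Suc s) x" if "x \<in> Vt (Suc s)" for x using that assms by (intro g_nonneg) auto
  have "(\<Sum>x\<in>Vt s. net.d s x * g t (Suc s) x) \<le> (\<Sum>x\<in>Vt s. net.d (Suc s) x * g t (Suc s) x)"
    using d_mono nn Suc_subset[of s] by (intro sum_mono mult_right_mono) auto
  also have "\<dots> \<le> (\<Sum>x\<in>Vt (Suc s). net.d (Suc s) x * g t (Suc s) x)"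
    using finite_Vt Suc_subset nn by (intro sum_mono2) (auto simp: d_eq)
  finally show ?thesis .
qed

text \<open>\<open>P\<close> preserves mass relative to the degrees of time \<open>s\<close>, and
  going back from \<open>Suc s\<close> to \<open>s\<close> only removes vertices and lowers
  degrees.\<close>

lemma g_mass: "s \<le> t \<Longrightarrow> (\<Sum>x\<in>Vt s. net.d s x * g t s x) \<le> 1"
proof (induction rule: inc_induct)
  case base
  have "(\<Sum>x\<in>Vt t. net.d t x * g t t x) = (\<Sum>x\<in>Vt t. if x = x0 then net.d t x0 / D else 0)"
    by (intro sum.cong) (auto simp: g_self)
  also have "\<dots> \<le> 1" using finite_Vt x0_in D[OF x0_in] D_ge_1 by (simp add: d_eq)
  finally show ?case .
next
  case (step s)
  have "(\<Sum>x\<in>Vt s. net.d s x * g t s x) = (\<Sum>x\<in>Vt s. net.d s x * g t (Suc s) x)"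
    unfolding g_step[OF step(2)] by (rule net.sum_d_P)
  then show ?case using g_mass_restrict[OF step(2)] step(3) by simp
qed

text \<open>Moving one step from \<open>u\<close> to \<open>g\<close> leaves the pairing unchanged
  (Chapman-Kolmogorov), so it may be evaluated at \<open>s = t\<close>, where \<open>g\<close> is a
  multiple of the indicator of \<open>x0\<close>.\<close>

lemma pairing: "s \<le> t \<Longrightarrow> (\<Sum>x\<in>Vt s. u s x * g t s x) = u t x0 / D"
proof (induction rule: inc_induct)
  case base
  have "(\<Sum>x\<in>Vt t. u t x * g t t x) = (\<Sum>x\<in>Vt t. if x = x0 then u t x0 / D else 0)"
    by (intro sum.cong) (auto simp: g_self)
  then show ?case using finite_Vt x0_in by simp
next
  case (step s)
  have "(\<Sum>x\<in>Vt s. u s x * g t s x)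
      = (\<Sum>x\<in>Vt s. \<Sum>y\<in>Vt s. u s x * srw_trans ends Et s x y * g t (Suc s) y)"
    unfolding g_step[OF step(2)]
    by (simp add: net.P_def srw_trans_eq sum_distrib_left sum_divide_distrib mult_ac)
  also have "\<dots> = (\<Sum>y\<in>Vt s. u (Suc s) y * g t (Suc s) y)"
    using Suc_subset[of s] by (subst sum.swap) (auto simp: u_Suc subset_iff sum_distrib_right intro!: sum.cong)
  also have "\<dots> = (\<Sum>y\<in>Vt (Suc s). u (Suc s) y * g t (Suc s) y)"
    using finite_Vt Suc_subset u_outside by (intro sum.mono_neutral_left) auto
  finally show ?case using step(3) by simp
qed

lemma return_le:
  assumes "s \<le> t"
  shows "u t x0 \<le> D * sqrt (net.energy s (h s) * net.energy s (g t s))"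
proof -
  have dp: "0 < net.d s x" if "x \<in> Vt s" for x using net.d_pos that by auto
  have "(\<Sum>x\<in>Vt s. u s x * g t s x) = (\<Sum>x\<in>Vt s. (sqrt (net.d s x) * h s x) * (sqrt (net.d s x) * g t s x))"
  proof (rule sum.cong)
    fix x assume x: "x \<in> Vt s"
    have "(sqrt (net.d s x) * h s x) * (sqrt (net.d s x) * g t s x)
        = (sqrt (net.d s x) * sqrt (net.d s x)) * (h s x * g t s x)" by (simp only: mult_ac)
    also have "\<dots> = u s x * g t s x" using dp[OF x] by (simp add: h_def)
    finally show "u s x * g t s x = (sqrt (net.d s x) * h s x) * (sqrt (net.d s x) * g t s x)" ..
  qed simp
  then have "u t x0 / D = (\<Sum>x\<in>Vt s. (sqrt (net.d s x) * h s x) * (sqrt (net.d s x) * g t s x))"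
    using pairing[OF assms] by simp
  then have "(u t x0 / D)\<^sup>2 \<le> (\<Sum>x\<in>Vt s. (sqrt (net.d s x) * h s x)\<^sup>2) * (\<Sum>x\<in>Vt s. (sqrt (net.d s x) * g t s x)\<^sup>2)"
    by (simp only: Cauchy_Schwarz_ineq_sum)
  also have "\<dots> = net.energy s (h s) * net.energy s (g t s)"
    using dp by (simp add: net.energy_def power_mult_distrib less_imp_le)
  finally have "u t x0 / D \<le> sqrt (net.energy s (h s) * net.energy s (g t s))" by (rule real_le_rsqrt)
  then show ?thesis using D_ge_1 by (simp add: pos_divide_le_eq mult.commute)
qed

lemma energy_g_self: "net.energy t (g t t) \<le> 1"
proof -
  have "net.energy t (g t t) = (\<Sum>x\<in>Vt t. if x = x0 then net.d t x0 / D\<^sup>2 else 0)"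
    unfolding net.energy_def by (intro sum.cong) (auto simp: g_self power_divide)
  also have "\<dots> = net.d t x0 / D\<^sup>2" using finite_Vt x0_in by simp
  also have "\<dots> \<le> 1"
  proof -
    have "net.d t x0 \<le> D * 1" using D[OF x0_in] by (simp add: d_eq)
    also have "\<dots> \<le> D * D" using D_ge_1 by (intro mult_left_mono) auto
    finally show ?thesis using D_ge_1 by (simp add: power2_eq_square)
  qed
  finally show ?thesis .
qed

theorem summable_return:
  assumes vol: "summable (\<lambda>t. 1 / real (vol ends (Et t)))"
    and cheeger: "summable (\<lambda>t. exp (- (\<Sum>s=t div 2..<t. (cheeger ends (Et s))\<^sup>2)))"
  shows "summable (\<lambda>t. u t x0)"
proof (rule summable_return_probabilities[where v = net.v and K = "8 / \<gamma> ^ 4" and \<gamma> = \<gamma> and D = D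
      and m = "\<lambda>s. (cheeger ends (Et s))\<^sup>2" and a = "\<lambda>s. net.energy s (h s)"
      and b = "\<lambda>t s. net.energy s (g t s)"])
  show "summable (\<lambda>t. 1 / net.v t)" using vol by (simp add: v_eq)
  show "net.energy (Suc s) (h (Suc s)) \<le> net.energy s (h s)" for s
    using energy_h_Suc_le net.energy_P_le by (rule order_trans)
  show "net.energy s (h s) \<le> 8 / \<gamma> ^ 4 / net.v s \<or>
      net.energy (Suc s) (h (Suc s)) \<le> net.energy s (h s) * exp (- (1 + \<gamma>) * (cheeger ends (Et s))\<^sup>2) \<and>
      (net.energy (Suc s) (h (Suc s)))\<^sup>2 * (1 + (net.energy s (h s))\<^sup>2 / 16) \<le> (net.energy s (h s))\<^sup>2" for s
  proof (cases "8 / \<gamma> ^ 4 / net.v s \<le> net.energy s (h s)")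
    case True
    note st = energy_step[OF h_nonneg h_mass True]
    have "(net.energy (Suc s) (h (Suc s)))\<^sup>2 * (1 + (net.energy s (h s))\<^sup>2 / 16)
        \<le> (net.energy s (net.P s (h s)))\<^sup>2 * (1 + (net.energy s (h s))\<^sup>2 / 16)"
      using energy_h_Suc_le net.energy_nonneg by (intro mult_right_mono power_mono) auto
    then show ?thesis using st energy_h_Suc_le[of s] by linarith
  qed simp
  show g_Suc: "net.energy s (g t s) \<le> net.energy (Suc s) (g t (Suc s))" if "s < t" for s t
    unfolding g_step[OF that] using net.energy_P_le energy_mono by (rule order_trans)
  show "net.energy s (g t s) \<le> 8 / \<gamma> ^ 4 / net.v s \<or>
      net.energy s (g t s) \<le> net.energy (Suc s) (g t (Suc s)) * exp (- (1 + \<gamma>) * (cheeger ends (Et s))\<^sup>2) \<and>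
      (net.energy s (g t s))\<^sup>2 * (1 + (net.energy (Suc s) (g t (Suc s)))\<^sup>2 / 16)
        \<le> (net.energy (Suc s) (g t (Suc s)))\<^sup>2" if "s < t" for s t
  \<comment> \<open>The averaging acts on \<open>g t (Suc s)\<close> with the degrees of time
    \<open>s\<close>, so that energy decides the case; if it lies below the floor, \<open>P\<close>
    keeps it there.\<close>
  proof (cases "8 / \<gamma> ^ 4 / net.v s \<le> net.energy s (g t (Suc s))")
    case True
    have nn: "0 \<le> g t (Suc s) x" if "x \<in> Vt s" for x
      using that \<open>s < t\<close> Suc_subset by (intro g_nonneg) auto
    have mass: "(\<Sum>x\<in>Vt s. net.d s x * g t (Suc s) x) \<le> 1"
      using g_mass_restrict[OF that] g_mass[of "Suc s" t] that by simp
    define z z' y where "z = net.energy s (g t (Suc s))" and "z' = net.energy (Suc s) (g t (Suc s))"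
      and "y = net.energy s (g t s)"
    have z: "0 \<le> z" "z \<le> z'" "0 \<le> y" unfolding z_def z'_def y_def by (rule net.energy_nonneg energy_mono)+
    have st: "y \<le> z * exp (- (1 + \<gamma>) * (cheeger ends (Et s))\<^sup>2)" "y\<^sup>2 * (1 + z\<^sup>2 / 16) \<le> z\<^sup>2"
      using energy_step[OF nn mass True] unfolding y_def z_def g_step[OF that] by auto
    have "z * exp (- (1 + \<gamma>) * (cheeger ends (Et s))\<^sup>2) \<le> z' * exp (- (1 + \<gamma>) * (cheeger ends (Et s))\<^sup>2)"
      using z by (intro mult_right_mono) auto
    \<comment> \<open>Replacing \<open>z\<close> by the larger \<open>z'\<close> adds
      \<open>y^2 / 16 * (z'^2 - z^2)\<close> on the left and \<open>z'^2 - z^2\<close> on the right;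
      the bound survives because the contraction itself forces \<open>y^2 \<le> 16\<close>.\<close>
    moreover have "y\<^sup>2 * (1 + z'\<^sup>2 / 16) \<le> z'\<^sup>2"
    proof -
      have "y\<^sup>2 \<le> y\<^sup>2 * (1 + z\<^sup>2 / 16)" by (simp add: algebra_simps)
      then have yz: "y\<^sup>2 \<le> z\<^sup>2" using st(2) by simp
      have zz: "z\<^sup>2 \<le> z'\<^sup>2" using z by (intro power_mono) auto
      have y16: "y\<^sup>2 \<le> 16"
      proof -
        have "y\<^sup>2 * (1 + z\<^sup>2 / 16) = y\<^sup>2 + y\<^sup>2 * z\<^sup>2 / 16" by (simp add: algebra_simps)
        then have "y\<^sup>2 * z\<^sup>2 \<le> 16 * z\<^sup>2" using st(2) zero_le_power2[of y] by linarith
        then show ?thesis using yz by (cases "z = 0") auto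
      qed
      have "y\<^sup>2 * (1 + z'\<^sup>2 / 16) = y\<^sup>2 * (1 + z\<^sup>2 / 16) + y\<^sup>2 / 16 * (z'\<^sup>2 - z\<^sup>2)"
        by (simp add: field_simps)
      also have "\<dots> \<le> z\<^sup>2 + 1 * (z'\<^sup>2 - z\<^sup>2)"
        using st(2) y16 zz by (intro add_mono mult_right_mono) auto
      finally show ?thesis by simp
    qed
    ultimately show ?thesis using st(1) unfolding y_def z'_def by linarith
  next
    case False
    then have "net.energy s (g t s) \<le> 8 / \<gamma> ^ 4 / net.v s"
      unfolding g_step[OF that] using net.energy_P_le[of s "g t (Suc s)"] by linarith
    then show ?thesis by simp
  qed
  show "0 < 8 / \<gamma> ^ 4" "0 \<le> D" using laziness D_ge_1 by auto
qed (assumption | rule laziness v_ge_1 v_mono cheeger u_nonneg return_le energy_h_0 net.energy_nonneg energy_g_self zero_le_power2)+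

end

section \<open>One-step law of a Markov chain\<close>

lemma measurable_state [measurable]:
  assumes "X \<in> measurable M (count_space S)"
  shows "{\<omega> \<in> space M. X \<omega> = x} \<in> sets M"
proof -
  have "{\<omega> \<in> space M. X \<omega> = x} = X -` ({x} \<inter> S) \<inter> space M"
    using measurable_space[OF assms] by auto
  then show ?thesis using measurable_sets[OF assms, of "{x} \<inter> S"] by simp
qed

text \<open>The Markov property conditions on whole histories, so the law is split over the finitely
  many paths in \<open>W\<close> up to time \<open>t\<close>, which are then grouped by their last
  state.\<close>

lemma markov_chain_step:
  assumes mc: "markov_chain M S P X" and W: "finite W"
    and AE: "\<And>i. i \<le> t \<Longrightarrow> AE \<omega> in M. X i \<omega> \<in> W" and y: "y \<in> S"
  shows "\<P>(\<omega> in M. X (Suc t) \<omega> = y) = (\<Sum>x\<in>W. \<P>(\<omega> in M. X t \<omega> = x) * P t x y)"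
proof -
  interpret prob_space M using mc by (simp add: markov_chain_def)
  have X: "X i \<in> measurable M (count_space S)" for i using mc by (simp add: markov_chain_def)
  note ms [measurable] = measurable_state[OF X]
  define paths where "paths = PiE {..t} (\<lambda>_. W)"
  have fin: "finite paths" unfolding paths_def using W by (intro finite_PiE) auto
  have AE': "AE \<omega> in M. \<forall>i\<in>{..t}. X i \<omega> \<in> W"
    using AE by (intro AE_finite_allI) auto
  have total: "\<P>(\<omega> in M. X s \<omega> = z) = (\<Sum>xs\<in>paths. \<P>(\<omega> in M. X s \<omega> = z \<and> (\<forall>i\<le>t. X i \<omega> = xs i)))" for s z
  proof (rule prob_sum[OF fin])
    show "AE \<omega> in M. (\<forall>xs\<in>paths. X s \<omega> = z \<and> (\<forall>i\<le>t. X i \<omega> = xs i) \<longrightarrow> X s \<omega> = z) \<and>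
        (X s \<omega> = z \<longrightarrow> (\<exists>!xs\<in>paths. X s \<omega> = z \<and> (\<forall>i\<le>t. X i \<omega> = xs i)))"
      using AE'
    proof eventually_elim
      case (elim \<omega>)
      have "\<exists>!xs\<in>paths. (\<forall>i\<le>t. X i \<omega> = xs i)"
      proof (rule ex1I[of _ "restrict (\<lambda>i. X i \<omega>) {..t}"])
        fix xs assume "xs \<in> paths \<and> (\<forall>i\<le>t. X i \<omega> = xs i)"
        then show "xs = restrict (\<lambda>i. X i \<omega>) {..t}"
          by (auto simp: paths_def PiE_def extensional_def fun_eq_iff)
      qed (use elim in \<open>auto simp: paths_def\<close>)
      then show ?case by auto
    qed
  qed measurable
  have state: "\<P>(\<omega> in M. X t \<omega> = z \<and> (\<forall>i\<le>t. X i \<omega> = xs i)) = (if xs t = z then \<P>(\<omega> in M. \<forall>i\<le>t. X i \<omega> = xs i) else 0)" for xs z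
  proof (cases "xs t = z")
    case True
    then show ?thesis by (auto intro!: arg_cong[where f = "measure M"])
  next
    case False
    then have "{\<omega> \<in> space M. X t \<omega> = z \<and> (\<forall>i\<le>t. X i \<omega> = xs i)} = {}" by auto
    then show ?thesis using False by (simp only: measure_empty if_False)
  qed
  \<comment> \<open>A history of probability zero is not constrained by the Markov property; for it
    both sides vanish.\<close>
  have step: "\<P>(\<omega> in M. X (Suc t) \<omega> = y \<and> (\<forall>i\<le>t. X i \<omega> = xs i)) = \<P>(\<omega> in M. \<forall>i\<le>t. X i \<omega> = xs i) * P t (xs t) y" for xs
  proof (cases "\<P>(\<omega> in M. \<forall>i\<le>t. X i \<omega> = xs i) > 0")
    case True
    then have "\<P>(\<omega> in M. X (Suc t) \<omega> = y \<bar> \<forall>i\<le>t. X i \<omega> = xs i) = P t (xs t) y"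
      using mc y by (simp add: markov_chain_def)
    then show ?thesis using True by (simp add: cond_prob_def field_simps)
  next
    case False
    then have 0: "\<P>(\<omega> in M. \<forall>i\<le>t. X i \<omega> = xs i) = 0" by (simp add: zero_less_measure_iff)
    have "\<P>(\<omega> in M. X (Suc t) \<omega> = y \<and> (\<forall>i\<le>t. X i \<omega> = xs i)) \<le> \<P>(\<omega> in M. \<forall>i\<le>t. X i \<omega> = xs i)"
      by (intro finite_measure_mono) (auto, measurable)
    then show ?thesis using 0 by (simp add: measure_le_0_iff)
  qed
  have "\<P>(\<omega> in M. X (Suc t) \<omega> = y) = (\<Sum>xs\<in>paths. \<P>(\<omega> in M. \<forall>i\<le>t. X i \<omega> = xs i) * P t (xs t) y)"
    unfolding total[of "Suc t" y] step ..
  also have "\<dots> = (\<Sum>xs\<in>paths. \<Sum>x\<in>W. if xs t = x then \<P>(\<omega> in M. \<forall>i\<le>t. X i \<omega> = xs i) * P t x y else 0)"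
    using W by (intro sum.cong) (auto simp: paths_def)
  also have "\<dots> = (\<Sum>x\<in>W. \<P>(\<omega> in M. X t \<omega> = x) * P t x y)"
    unfolding total[of t] state
    by (subst sum.swap) (auto intro!: sum.cong simp: sum_distrib_right)
  finally show ?thesis .
qed

lemma (in prob_space) AE_state_set_iff:
  assumes X: "X \<in> measurable M (count_space S)" and W: "finite W"
  shows "(AE \<omega> in M. X \<omega> \<in> W) \<longleftrightarrow> (\<Sum>x\<in>W. \<P>(\<omega> in M. X \<omega> = x)) = 1"
proof -
  have "{\<omega> \<in> space M. X \<omega> \<in> W} = (\<Union>x\<in>W. {\<omega> \<in> space M. X \<omega> = x})" by auto
  then have ev: "{\<omega> \<in> space M. X \<omega> \<in> W} \<in> events" using W measurable_state[OF X] by auto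
  have "\<P>(\<omega> in M. X \<omega> \<in> W) = (\<Sum>x\<in>W. \<P>(\<omega> in M. X \<omega> = x))"
    using W measurable_state[OF X] ev by (intro prob_sum) auto
  then show ?thesis using prob_Collect_eq_1[OF ev] by simp
qed

text \<open>The expected number of visits is the sum of the visiting probabilities, by exchanging
  the integral with a series of nonnegative terms.\<close>

lemma strong_transientI:
  assumes "prob_space M" "\<And>t. X t \<in> measurable M (count_space S)" "summable (\<lambda>t. \<P>(\<omega> in M. X t \<omega> = x))"
  shows "strong_transient M X x"
proof -
  interpret prob_space M by fact
  note ms [measurable] = measurable_state[OF assms(2)]
  have "(\<integral>\<^sup>+\<omega>. num_visits X x \<omega> \<partial>M) = (\<integral>\<^sup>+\<omega>. (\<Sum>t. indicator {\<omega> \<in> space M. X t \<omega> = x} \<omega>) \<partial>M)"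
    unfolding num_visits_def by (intro nn_integral_cong suminf_cong) (auto simp: indicator_def)
  also have "\<dots> = (\<Sum>t. \<integral>\<^sup>+\<omega>. indicator {\<omega> \<in> space M. X t \<omega> = x} \<omega> \<partial>M)"
    by (rule nn_integral_suminf) measurable
  also have "\<dots> = (\<Sum>t. ennreal (\<P>(\<omega> in M. X t \<omega> = x)))"
    by (simp add: emeasure_eq_measure)
  also have "\<dots> = ennreal (\<Sum>t. \<P>(\<omega> in M. X t \<omega> = x))"
    using assms(3) by (intro suminf_ennreal2) auto
  finally show ?thesis by (simp add: strong_transient_def)
qed

section \<open>Transience\<close>

lemma summable_on_atLeast1_imp_summable:
  fixes f :: "nat \<Rightarrow> real"
  assumes "f summable_on {1..}" "\<And>t. 0 \<le> f t"
  shows "summable f"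
proof -
  have "f summable_on insert 0 {1..}" using assms(1) by (simp add: summable_on_insert_iff)
  also have "insert 0 {1..} = (UNIV :: nat set)" by auto
  finally show ?thesis using assms(2) by (simp add: summable_on_UNIV_nonneg_real_iff)
qed

theorem proposition1p6:
  fixes V :: "'a set" and E :: "'e set" and ends :: "'e \<Rightarrow> 'a set" and Et :: "nat \<Rightarrow> 'e set"
    and M :: "'w measure" and X :: "nat \<Rightarrow> 'w \<Rightarrow> 'a" and x0 :: 'a and \<gamma> :: real
  assumes graphs: "growing_graphs V E ends Et"
    and start: "x0 \<in> nonisolated ends (Et 0)"
    and walk: "simple_random_walk M V ends Et x0 X"
    and gamma: "0 < \<gamma>" "\<gamma> \<le> 1 / 2"
    and lazy: "\<And>t x. x \<in> nonisolated ends (Et t) \<Longrightarrow> srw_trans ends Et t x x \<ge> \<gamma>"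
    and bounded_degrees:
      "(SUP t. SUP x\<in>nonisolated ends (Et t). enat (deg ends (Et t) x)) < \<infinity>"
    and volume_growth: "(\<lambda>t. 1 / real (vol ends (Et t))) summable_on {1..}"
    and cheeger_growth:
      "(\<lambda>t. exp (- (\<Sum>u=t div 2..t - 1. (cheeger ends (Et u))\<^sup>2))) summable_on {1..}"
  shows "strong_transient M X x0"
proof -
  interpret growing_graphs V E ends Et by (rule graphs)
  interpret lazy_growing_graphs V E ends Et x0 \<gamma>
    by unfold_locales (use start gamma lazy in auto)
  have mc: "markov_chain M V (srw_trans ends Et) X" and X0: "AE \<omega> in M. X 0 \<omega> = x0"
    using walk by (auto simp: simple_random_walk_def)
  then interpret prob_space M by (simp add: markov_chain_def)
  have X: "X t \<in> measurable M (count_space V)" for t using mc by (simp add: markov_chain_def)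
  define u where "u t x = \<P>(\<omega> in M. X t \<omega> = x)" for t x
  have step: "u (Suc t) y = (\<Sum>x\<in>Vt t. u t x * srw_trans ends Et t x y)"
    if "\<And>i. i \<le> t \<Longrightarrow> AE \<omega> in M. X i \<omega> \<in> Vt i" "y \<in> V" for t y
    unfolding u_def
  proof (rule markov_chain_step[OF mc finite_Vt _ that(2)])
    fix i assume "i \<le> t"
    from that(1)[OF this] show "AE \<omega> in M. X i \<omega> \<in> Vt t"
      by eventually_elim (use nonisolated_mono[OF \<open>i \<le> t\<close>] in auto)
  qed
  \<comment> \<open>Strong induction, since \<open>step\<close> needs the supports at all earlier
    times. The transition rows of \<open>Vt s\<close> sum to one over \<open>Vt s\<close>, so the
    whole mass stays there at time \<open>Suc s\<close>.\<close>
  have supp: "AE \<omega> in M. X t \<omega> \<in> Vt t" for t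
  proof (induction t rule: less_induct)
    case (less t)
    show ?case
    proof (cases t)
      case 0
      show ?thesis using X0 start unfolding 0 by auto
    next
      case (Suc s)
      have "(\<Sum>y\<in>Vt s. u (Suc s) y) = (\<Sum>y\<in>Vt s. \<Sum>x\<in>Vt s. u s x * srw_trans ends Et s x y)"
        using less.IH nonisolated_subset unfolding Suc by (intro sum.cong step) auto
      also have "\<dots> = (\<Sum>x\<in>Vt s. u s x)"
        by (subst sum.swap) (simp add: sum_distrib_left[symmetric] sum_srw_trans)
      also have "\<dots> = 1"
        using AE_state_set_iff[OF X finite_Vt[of s], of s] less.IH[of s] by (simp add: u_def Suc)
      finally have "AE \<omega> in M. X t \<omega> \<in> Vt s"
        unfolding Suc u_def using AE_state_set_iff[OF X finite_Vt] by blast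
      then show ?thesis by eventually_elim (use Suc_subset[of s] Suc in auto)
    qed
  qed
  obtain D where D: "\<And>t x. x \<in> Vt t \<Longrightarrow> deg ends (Et t) x \<le> D"
  proof -
    \<comment> \<open>A finite supremum in the extended naturals is a natural number, which serves
      as common degree bound.\<close>
    obtain D where D: "(SUP t. SUP x\<in>Vt t. enat (deg ends (Et t) x)) = enat D"
      using bounded_degrees by (auto simp: less_infinityE)
    have "enat (deg ends (Et t) x) \<le> enat D" if "x \<in> Vt t" for t x
      unfolding D[symmetric] using that by (intro SUP_upper2[of t] SUP_upper) auto
    then show thesis by (intro that) auto
  qed
  interpret return_law V E ends Et x0 \<gamma> "real D" u
  proof
    show "0 \<le> u t x" for t x by (simp add: u_def)
    show "u 0 x = of_bool (x = x0)" if "x \<in> Vt 0" for x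
    proof (cases "x = x0")
      case True
      have "{\<omega> \<in> space M. X 0 \<omega> = x0} \<in> events" by (rule measurable_state[OF X])
      then show ?thesis using X0 True by (simp add: u_def prob_Collect_eq_1)
    next
      case False
      have "{\<omega> \<in> space M. X 0 \<omega> = x} \<in> events" by (rule measurable_state[OF X])
      moreover have "AE \<omega> in M. X 0 \<omega> \<noteq> x" using X0 by eventually_elim (use False in auto)
      ultimately show ?thesis using False by (simp add: u_def prob_Collect_eq_0)
    qed
    show "u (Suc t) y = (\<Sum>x\<in>Vt t. u t x * srw_trans ends Et t x y)" if "y \<in> Vt (Suc t)" for t y
      using that nonisolated_subset supp by (intro step) auto
    show "(\<Sum>x\<in>Vt t. u t x) = 1" for t
      using AE_state_set_iff[OF X finite_Vt[of t]] supp[of t] by (simp add: u_def)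
  qed (use D in auto)
  have "summable (\<lambda>t. 1 / real (vol ends (Et t)))"
    using volume_growth by (rule summable_on_atLeast1_imp_summable) simp
  moreover have "summable (\<lambda>t. exp (- (\<Sum>s=t div 2..<t. (cheeger ends (Et s))\<^sup>2)))"
  proof -
    \<comment> \<open>At \<open>t = 0\<close> the two index sets differ, truncated subtraction
      making the second one \<open>{0..0}\<close>; the comparison is therefore confined to
      \<open>t \<ge> 1\<close>.\<close>
    have window: "{t div 2..<t} = {t div 2..t - 1}" if "t \<in> {1..}" for t :: nat using that by auto
    have "(\<lambda>t. exp (- (\<Sum>s=t div 2..<t. (cheeger ends (Et s))\<^sup>2))) summable_on {1..} \<longleftrightarrow>
        (\<lambda>t. exp (- (\<Sum>s=t div 2..t - 1. (cheeger ends (Et s))\<^sup>2))) summable_on {1..}"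
      by (rule summable_on_cong) (simp only: window)
    then have "(\<lambda>t. exp (- (\<Sum>s=t div 2..<t. (cheeger ends (Et s))\<^sup>2))) summable_on {1..}"
      using cheeger_growth by simp
    then show ?thesis by (rule summable_on_atLeast1_imp_summable) simp
  qed
  ultimately have "summable (\<lambda>t. \<P>(\<omega> in M. X t \<omega> = x0))"
    using summable_return by (simp add: u_def)
  then show ?thesis by (rule strong_transientI[OF prob_space_axioms X])
qed

end
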